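(* Let $h$ be a Borel measurable, real-valued integrable function, and let $X\sim\mathcal N_p(\mu,\Sigma)$, where $\Sigma$ is a nonnegative definite $p\times p$ matrix with rank $k\le p$. Let $A$ be a $p\times p$ nonnegative definite matrix with rank $k$ such that $\Sigma A$ is idempotent, $A\Sigma A=A$, $\Sigma A\Sigma=\Sigma$ and $\Sigma A\mu=\mu$, and let $W=A^{1/2}W^*A^{1/2}$, where $W^*$ is a nonnegative definite $p\times p$ matrix. Then $$E[h(X'AX)\,WX]=E\bigl[h(\chi^2_{k+2}(\mu'A\mu))\bigr]\,W\mu .$$
   Context: $\chi^2_\nu(\Delta)$ denotes a noncentral chi-square variable with $\nu$ degrees of freedom and noncentrality $\Delta$, i.e. the law of $\|N\|^2$ with $N\sim\mathcal N_\nu(\theta,I_\nu)$ and $\|\theta\|^2=\Delta$. Nonnegative definite matrices are symmetric; $A^{1/2}$ is the nonnegative definite square root. A normal law with singular covariance is allowed. "Integrable" means (with respect to the relevant Gaussian measure) that the expectations appearing in the identity are well defined and finite. *)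

theory Defs
  imports "HOL-Probability.Probability"
begin

definition nonneg_def :: "real ^ 'n ^ 'n \<Rightarrow> bool" where
  "nonneg_def A \<longleftrightarrow> transpose A = A \<and> (\<forall>x. 0 \<le> x \<bullet> (A *v x))"

text \<open>Only meaningful for nonnegative definite \<open>A\<close>, where exactly one such \<open>B\<close> exists.\<close>

definition nonneg_sqrt :: "real ^ 'n ^ 'n \<Rightarrow> real ^ 'n ^ 'n" where
  "nonneg_sqrt A = (THE B. nonneg_def B \<and> B ** B = A)"

definition std_mvn :: "(real ^ 'n) measure" where
  "std_mvn = density lborel (\<lambda>z. ennreal (\<Prod>i\<in>UNIV. std_normal_density (z $ i)))"

text \<open>Defined as the law of \<open>\<mu> + \<Sigma>\<^sup>1\<^sup>/\<^sup>2 Z\<close> with \<open>Z\<close> standard normal rather than by a density,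
  so that the covariance \<open>\<Sigma>\<close> may be singular.\<close>

definition mvn :: "real ^ 'n \<Rightarrow> real ^ 'n ^ 'n \<Rightarrow> (real ^ 'n) measure" where
  "mvn \<mu> \<Sigma> = distr std_mvn borel (\<lambda>z. \<mu> + nonneg_sqrt \<Sigma> *v z)"

text \<open>The number \<open>\<nu>\<close> of degrees of freedom is a term (in use it depends on the rank of a matrix),
  so the vector with law \<open>N(\<theta>, I)\<close> in dimension \<open>\<nu>\<close> is indexed by \<open>{..<\<nu>}\<close> instead of by a type.
  Any \<open>\<theta>\<close> whose squared norm is \<open>\<Delta>\<close> is admitted; the law does not depend on this choice.\<close>

definition noncentral_chi_square :: "nat \<Rightarrow> real \<Rightarrow> real measure \<Rightarrow> bool" where
  "noncentral_chi_square \<nu> \<Delta> Q \<longleftrightarrow>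
     (\<exists>\<theta> :: nat \<Rightarrow> real. (\<Sum>i<\<nu>. (\<theta> i)\<^sup>2) = \<Delta> \<and>
        Q = distr (\<Pi>\<^sub>M i\<in>{..<\<nu>}. density lborel (\<lambda>x. ennreal (normal_density (\<theta> i) 1 x)))
              borel (\<lambda>x. \<Sum>i<\<nu>. (x i)\<^sup>2))"

end

theory Submission
  imports Defs
begin

text \<open>Let \<open>S = \<Sigma>\<^sup>1\<^sup>/\<^sup>2\<close>, \<open>P = S A S\<close> and \<open>w = S A \<mu>\<close>. Then \<open>P\<close> is an orthogonal projection of rank \<open>k\<close>
  that fixes \<open>w\<close>, \<open>|w|\<^sup>2 = \<mu>'A\<mu>\<close>, and for \<open>X = \<mu> + S Z\<close> with \<open>Z\<close> standard normal one has
  \<open>X'AX = |P(w + Z)|\<^sup>2\<close> and \<open>W X = W S (w + Z)\<close>. If \<open>w = 0\<close>, both sides vanish because the law of \<open>Z\<close> is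
  symmetric. Otherwise averaging over the reflection of \<open>Z\<close> that fixes the line through \<open>w\<close> replaces
  \<open>W S (w + Z)\<close> by the multiple \<open>U / |w|\<close> of \<open>W S w = W \<mu>\<close>, where \<open>U\<close> is the component of \<open>w + Z\<close> along \<open>w\<close>.
  Since \<open>|P(w + Z)|\<^sup>2 = U\<^sup>2 + R\<close> with \<open>U \<sim> N(|w|, 1)\<close> and \<open>R \<sim> \<chi>\<^sup>2(k - 1)\<close> independent, conditioning on
  \<open>R\<close> reduces the claim to \<open>E[g(U\<^sup>2) U] = |w| E[g(V)]\<close> with \<open>V\<close> noncentral chi-square with 3 degrees of
  freedom and noncentrality \<open>|w|\<^sup>2\<close>, an identity between explicit densities.\<close>

section \<open>Spectral theorem and square roots\<close>

text \<open>The count k + 2 arises because only \<open>U\<close> carries the weight: its single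
  square is traded for one with 3 degrees of freedom, while the k - 1 of \<open>R\<close> stay.
  Dimension 3 is convenient because two central squares add up to an exponential variable of rate
  1/2, whose factor exp(x^2 / 2) cancels the quadratic term of a Gaussian density and leaves an
  elementary integral. Since \<open>\<Sigma>\<close> may be singular, \<open>X\<close> need not have
  a density, so all laws are computed from \<open>Z\<close> in the full space. Integrability shapes
  the rest. The identities between laws are proved for extended nonnegative integrands, and
  \<open>h\<close> is split into positive and negative parts only afterwards. The hypothesis on the
  vector h(X'AX) W X controls the scalar h(|P(w + Z)|^2) U only when W \<mu> is nonzero; if W \<mu>
  = 0, averaging over the reflection makes both sides vanish.\<close>

lemma matrix_inner_commute:
  fixes A :: "real ^ 'n ^ 'n"
  assumes "transpose A = A"
  shows "(A *v x) \<bullet> y = x \<bullet> (A *v y)"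
  by (metis assms dot_lmul_matrix inner_commute vector_transpose_matrix)

text \<open>The quadratic form x . f x attains its maximum on the compact unit sphere of
  \<open>V\<close>, and a maximiser is an eigenvector: moving from \<open>e\<close> along the
  residual \<open>u = c e - f e\<close> changes the form to first order, which is compatible with
  maximality only if \<open>u = 0\<close>.\<close>

lemma symmetric_eigenvector:
  fixes f :: "'a::euclidean_space \<Rightarrow> 'a"
  assumes f: "linear f" and sym: "\<And>x y. f x \<bullet> y = x \<bullet> f y"
    and V: "subspace V" "f ` V \<subseteq> V" "V \<noteq> {0}"
  obtains e c where "e \<in> V" "norm e = 1" "f e = c *\<^sub>R e"
proof -
  let ?S = "sphere 0 1 \<inter> V"
  have "compact ?S" using V by (intro compact_Int_closed closed_subspace) auto
  moreover have "?S \<noteq> {}"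
  proof -
    obtain v where v: "v \<in> V" "v \<noteq> 0" using V subspace_0 by blast
    then have "(1 / norm v) *\<^sub>R v \<in> ?S" using V by (simp add: subspace_scale)
    then show ?thesis by blast
  qed
  moreover have "continuous_on ?S (\<lambda>x. x \<bullet> f x)"
    using f by (intro continuous_intros linear_continuous_on) (metis linear_conv_bounded_linear)
  ultimately have "\<exists>e\<in>?S. \<forall>y\<in>?S. y \<bullet> f y \<le> e \<bullet> f e"
    by (rule continuous_attains_sup)
  then obtain e where e: "e \<in> ?S" and max: "\<And>y. y \<in> ?S \<Longrightarrow> y \<bullet> f y \<le> e \<bullet> f e"
    by blast
  define c where "c = e \<bullet> f e"
  have ee: "e \<bullet> e = 1" using e by (simp add: norm_eq_1)
  have q: "y \<bullet> f y \<le> c * (y \<bullet> y)" if "y \<in> V" for y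
  proof (cases "y = 0")
    case True then show ?thesis by simp
  next
    case False
    have "(1 / norm y) *\<^sub>R y \<in> ?S" using V that False by (simp add: subspace_scale)
    from max[OF this] have "(y \<bullet> f y) / (norm y)\<^sup>2 \<le> c"
      by (simp add: linear_scale[OF f] c_def power2_eq_square)
    then show ?thesis using False by (simp add: power2_norm_eq_inner field_simps)
  qed
  define u where "u = c *\<^sub>R e - f e"
  have uV: "u \<in> V" unfolding u_def using e V by (auto intro!: subspace_diff subspace_scale)
  have "u = 0"
  proof (rule ccontr)
    assume "u \<noteq> 0"
    define a where "a = u \<bullet> u"
    define b where "b = c * a - u \<bullet> f u"
    have a: "a > 0" using \<open>u \<noteq> 0\<close> by (simp add: a_def)
    have b: "b \<ge> 0" using q[OF uV] by (simp add: b_def a_def)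
    have cross: "c * (e \<bullet> u) - f e \<bullet> u = a" by (simp add: a_def u_def inner_diff_left)
    have t: "0 \<le> 2 * t * a + t\<^sup>2 * b" for t
    proof -
      have "e + t *\<^sub>R u \<in> V" using e uV V by (auto intro!: subspace_add subspace_scale)
      from q[OF this] have "0 \<le> 2 * t * (c * (e \<bullet> u) - f e \<bullet> u) + t\<^sup>2 * b"
        using ee sym[of e u] sym[of u e]
        by (simp add: linear_add[OF f] linear_scale[OF f] inner_add_left inner_add_right
            c_def[symmetric] b_def a_def inner_commute power2_eq_square algebra_simps)
      then show ?thesis using cross by simp
    qed
    \<comment> \<open>For t = -s the linear term -2 s a outweighs s^2 b as soon as s b < a; the 1 in
      the denominator keeps the quotient meaningful when b = 0.\<close>
    define s where "s = a / (b + 1)"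
    have s: "s > 0" "s * b < a" using a b by (auto simp: s_def field_simps)
    have "s * (s * b) < s * a" using s by (intro mult_strict_left_mono) auto
    moreover have "0 \<le> 2 * (-s) * a + s\<^sup>2 * b" using t[of "-s"] by simp
    moreover have "0 < s * a" using s a by simp
    ultimately show False by (simp add: power2_eq_square algebra_simps)
  qed
  then show thesis using that[of e c] e by (simp add: u_def)
qed

text \<open>Induction on the dimension: the part of \<open>V\<close> orthogonal to a unit
  eigenvector is again invariant because \<open>f\<close> is symmetric. Invariant subspaces rather
  than the whole space are treated so that the induction hypothesis applies to that part.\<close>

theorem symmetric_eigenbasis:
  fixes f :: "'a::euclidean_space \<Rightarrow> 'a"
  assumes f: "linear f" and sym: "\<And>x y. f x \<bullet> y = x \<bullet> f y"
    and V: "subspace V" "f ` V \<subseteq> V"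
  shows "\<exists>E. E \<subseteq> V \<and> pairwise orthogonal E \<and> (\<forall>e\<in>E. norm e = 1) \<and> span E = V
    \<and> (\<forall>e\<in>E. \<exists>c. f e = c *\<^sub>R e)"
  using V
proof (induction "dim V" arbitrary: V rule: less_induct)
  case less
  show ?case
  proof (cases "V = {0}")
    case True
    then show ?thesis by (intro exI[of _ "{}"]) (auto simp: pairwise_def)
  next
    case False
    then obtain e c where e: "e \<in> V" "norm e = 1" "f e = c *\<^sub>R e"
      using symmetric_eigenvector[OF f sym less.prems(1,2)] by blast
    define V' where "V' = V \<inter> {x. e \<bullet> x = 0}"
    have sV': "subspace V'" unfolding V'_def
      using less.prems(1) subspace_hyperplane[of e] by (rule subspace_inter)
    have fV': "f ` V' \<subseteq> V'"
    proof
      fix y assume "y \<in> f ` V'"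
      then obtain x where x: "x \<in> V" "e \<bullet> x = 0" "y = f x" by (auto simp: V'_def)
      have "e \<bullet> f x = 0" using sym[of e x] e x by simp
      then show "y \<in> V'" using x less.prems by (auto simp: V'_def)
    qed
    have ee: "e \<bullet> e = 1" using e by (simp add: norm_eq_1)
    have "e \<notin> V'" using ee by (simp add: V'_def)
    moreover have "V' \<subseteq> V" by (auto simp: V'_def)
    ultimately have "V' \<subset> V" using e by blast
    then have "dim V' < dim V"
      by (intro dim_psubset) (metis less.prems(1) sV' span_eq_iff)
    from less.hyps[OF this sV' fV'] obtain E where E: "E \<subseteq> V'" "pairwise orthogonal E"
      "\<forall>e\<in>E. norm e = 1" "span E = V'" "\<forall>e\<in>E. \<exists>c. f e = c *\<^sub>R e" by blast
    have "span (insert e E) = V"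
    proof
      have "insert e E \<subseteq> V" using e E by (auto simp: V'_def)
      then show "span (insert e E) \<subseteq> V" using less.prems(1) span_minimal by blast
      show "V \<subseteq> span (insert e E)"
      proof
        fix x assume x: "x \<in> V"
        have "x - (e \<bullet> x) *\<^sub>R e \<in> V'" using x e ee less.prems(1)
          by (auto simp: V'_def inner_diff_right intro!: subspace_diff subspace_scale)
        then have "x - (e \<bullet> x) *\<^sub>R e \<in> span E" using E by simp
        then show "x \<in> span (insert e E)" by (auto simp: span_insert)
      qed
    qed
    moreover have "pairwise orthogonal (insert e E)"
      using E unfolding pairwise_insert by (auto simp: V'_def orthogonal_def inner_commute)
    ultimately show ?thesis using e E
      by (intro exI[of _ "insert e E"]) (auto simp: V'_def)
  qed
qed

lemma nonneg_sqrt_exists: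
  fixes A :: "real ^ 'n ^ 'n"
  assumes "nonneg_def A"
  shows "\<exists>B. nonneg_def B \<and> B ** B = A"
proof -
  have sym: "(A *v x) \<bullet> y = x \<bullet> (A *v y)" for x y
    using assms matrix_inner_commute by (auto simp: nonneg_def_def)
  obtain E where E: "pairwise orthogonal E" "\<forall>e\<in>E. norm e = 1" "span E = UNIV"
      "\<forall>e\<in>E. \<exists>c. A *v e = c *\<^sub>R e"
    using symmetric_eigenbasis[OF matrix_vector_mul_linear sym subspace_UNIV] by auto
  then obtain c where c: "\<And>e. e \<in> E \<Longrightarrow> A *v e = c e *\<^sub>R e" by metis
  have fin: "finite E" using E(1) pairwise_orthogonal_imp_finite by blast
  have ee: "e \<bullet> e = 1" if "e \<in> E" for e using E(2) that by (simp add: norm_eq_1)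
  have ed: "e \<bullet> d = (if d = e then 1 else 0)" if "e \<in> E" "d \<in> E" for e d
    using E(1) that ee by (auto simp: pairwise_def orthogonal_def)
  have cpos: "c e \<ge> 0" if "e \<in> E" for e
    using assms[unfolded nonneg_def_def] c[OF that] ee[OF that] by (metis inner_scaleR_right mult.right_neutral)
  define g where "g x = (\<Sum>e\<in>E. (sqrt (c e) * (e \<bullet> x)) *\<^sub>R e)" for x
  have lin: "linear g"
    by (rule linearI) (auto simp: g_def inner_add_right algebra_simps sum.distrib scaleR_sum_right)
  have gsym: "x \<bullet> g y = g x \<bullet> y" for x y
    by (simp add: g_def inner_sum_right inner_sum_left inner_commute mult_ac)
  have ge: "g e = sqrt (c e) *\<^sub>R e" if "e \<in> E" for e
  proof -
    have "g e = (\<Sum>d\<in>E. if d = e then sqrt (c e) *\<^sub>R e else 0)"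
      unfolding g_def using that by (intro sum.cong) (auto simp: ed)
    then show ?thesis using that fin by (simp add: sum.delta)
  qed
  define B where "B = matrix g"
  have B: "B *v x = g x" for x using lin by (simp add: B_def matrix_works)
  have "A *v x = (B ** B) *v x" for x
  proof (rule linear_eq_on_span[of "(*v) A" "(*v) (B ** B)" E])
    show "A *v e = (B ** B) *v e" if "e \<in> E" for e
      using that cpos[OF that] c[OF that]
      by (simp add: matrix_vector_mul_assoc[symmetric] B ge linear_scale[OF lin])
  qed (use E in auto)
  then have "B ** B = A" by (subst matrix_eq) simp
  moreover have "nonneg_def B"
    unfolding nonneg_def_def
  proof
    have "x \<bullet> (transpose B *v y) = x \<bullet> (B *v y)" for x y
      by (metis B gsym dot_lmul_matrix vector_transpose_matrix transpose_transpose)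
    then have "transpose B *v y = B *v y" for y using vector_eq_ldot by blast
    then show "transpose B = B" by (subst matrix_eq) simp
    have "x \<bullet> (B *v x) = (\<Sum>e\<in>E. sqrt (c e) * (e \<bullet> x)\<^sup>2)" for x
      by (simp add: B g_def inner_sum_right inner_commute power2_eq_square mult.assoc)
    then show "\<forall>x. 0 \<le> x \<bullet> (B *v x)" by (auto simp: cpos intro!: sum_nonneg)
  qed
  ultimately show ?thesis by blast
qed

text \<open>\<open>B\<close> and \<open>C\<close> are compared on an eigenbasis of
  \<open>D = B - C\<close>, which avoids showing that they commute. For a unit eigenvector
  \<open>e\<close> with eigenvalue \<open>l\<close>, |B e| = |C e| gives l (e . B e + e . C e) = 0;
  if the bracket vanishes, so do both of its nonnegative terms, and \<open>l\<close> is their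
  difference.\<close>

lemma nonneg_sqrt_unique:
  fixes B C :: "real ^ 'n ^ 'n"
  assumes B: "nonneg_def B" and C: "nonneg_def C" and eq: "B ** B = C ** C"
  shows "B = C"
proof -
  have tB: "transpose B = B" and tC: "transpose C = C" using B C by (auto simp: nonneg_def_def)
  define D where "D = B - C"
  have sym: "(D *v x) \<bullet> y = x \<bullet> (D *v y)" for x y
    using matrix_inner_commute[OF tB, of x y] matrix_inner_commute[OF tC, of x y]
    by (simp add: D_def matrix_vector_mult_diff_rdistrib inner_diff_left inner_diff_right)
  obtain E where E: "\<forall>e\<in>E. norm e = 1" "span E = UNIV" "\<forall>e\<in>E. \<exists>c. D *v e = c *\<^sub>R e"
    using symmetric_eigenbasis[OF matrix_vector_mul_linear sym subspace_UNIV] by auto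
  have D0: "D *v e = 0" if eE: "e \<in> E" for e
  proof -
    obtain l where l: "D *v e = l *\<^sub>R e" using E(3) eE by blast
    have ee: "e \<bullet> e = 1" using E(1) that by (simp add: norm_eq_1)
    have Be: "B *v e = C *v e + l *\<^sub>R e"
      using l unfolding D_def matrix_vector_mult_diff_rdistrib by (metis add.commute diff_add_cancel)
    have "(B *v e) \<bullet> (B *v e) = (C *v e) \<bullet> (C *v e)"
      using matrix_inner_commute[OF tB, of e "B *v e"] matrix_inner_commute[OF tC, of e "C *v e"] eq
      by (simp add: matrix_vector_mul_assoc)
    then have "l * (2 * (e \<bullet> (C *v e)) + l) = 0"
      unfolding Be using ee by (simp add: inner_add_left inner_add_right inner_commute algebra_simps)
    moreover have "e \<bullet> (B *v e) = e \<bullet> (C *v e) + l" using ee by (simp add: Be inner_add_right)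
    moreover have "e \<bullet> (B *v e) \<ge> 0" "e \<bullet> (C *v e) \<ge> 0" using B C by (auto simp: nonneg_def_def)
    ultimately have "l = 0" by (auto simp: add_nonneg_eq_0_iff)
    then show ?thesis using l by simp
  qed
  have "D *v x = 0 *v x" for x
    by (rule linear_eq_on_span[of "(*v) D" "(*v) 0" E]) (use E D0 in auto)
  then have "D = 0" by (subst matrix_eq) simp
  then show ?thesis by (simp add: D_def)
qed

lemma nonneg_sqrt:
  fixes A :: "real ^ 'n ^ 'n"
  assumes "nonneg_def A"
  shows "transpose (nonneg_sqrt A) = nonneg_sqrt A" "nonneg_sqrt A ** nonneg_sqrt A = A"
proof -
  have "\<exists>!B. nonneg_def B \<and> B ** B = A"
    using nonneg_sqrt_exists[OF assms] nonneg_sqrt_unique by metis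
  from theI'[OF this, folded nonneg_sqrt_def]
  show "transpose (nonneg_sqrt A) = nonneg_sqrt A" "nonneg_sqrt A ** nonneg_sqrt A = A"
    by (auto simp: nonneg_def_def)
qed

text \<open>Orthogonal extension is applied twice, from \<open>w\<close> to \<open>R\<close> and
  from there to the whole space, followed by normalisation. The basis is indexed by
  \<open>'n\<close> itself, so that its coordinates define a map of \<open>real ^ 'n\<close> to
  itself and a Gaussian vector can be rotated into it.\<close>

lemma adapted_orthonormal_basis:
  fixes w :: "real ^ 'n"
  assumes R: "subspace R" "w \<in> R" "w \<noteq> 0"
  obtains b :: "'n \<Rightarrow> real ^ 'n" and i0 where "\<And>i j. b i \<bullet> b j = (if i = j then 1 else 0)"
    "b i0 = (1 / norm w) *\<^sub>R w" "card {i. b i \<in> R} = dim R"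
    "\<And>i x. b i \<notin> R \<Longrightarrow> x \<in> R \<Longrightarrow> b i \<bullet> x = 0"
proof -
  have "pairwise orthogonal {w}" by (simp add: pairwise_def)
  then obtain U where U: "U \<inter> insert 0 {w} = {}" "pairwise orthogonal ({w} \<union> U)" "span ({w} \<union> U) = span ({w} \<union> R)"
    by (rule orthogonal_extension_strong)
  define E1 where "E1 = {w} \<union> U"
  have s1: "span E1 = R" using U R by (simp add: E1_def insert_absorb span_eq_iff)
  obtain U2 where U2: "U2 \<inter> insert 0 E1 = {}" "pairwise orthogonal (E1 \<union> U2)" "span (E1 \<union> U2) = span (E1 \<union> UNIV)"
    using orthogonal_extension_strong[of E1 UNIV] U(2) unfolding E1_def by blast
  define E where "E = E1 \<union> U2"
  have E: "pairwise orthogonal E" "0 \<notin> E" "span E = UNIV" "w \<in> E"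
    using U U2 R by (auto simp: E_def E1_def)
  have indE: "independent E" by (rule pairwise_orthogonal_independent) (use E in auto)
  have cE: "card E = CARD('n)" using dim_eq_card[of E UNIV] E indE by simp
  have fE: "finite E" using indE independent_imp_finite by blast
  have ind1: "independent E1" using indE independent_mono by (auto simp: E_def)
  have c1: "card E1 = dim R" using dim_eq_card[of E1 R] ind1 s1 R by (metis span_eq_iff)
  obtain g :: "'n \<Rightarrow> real ^ 'n" where g: "bij_betw g UNIV E"
    using fE cE by (metis finite_same_card_bij finite_class.finite_UNIV)
  define b where "b i = (1 / norm (g i)) *\<^sub>R g i" for i
  have gE: "g i \<in> E" for i using g by (auto simp: bij_betw_def)
  have gn: "g i \<noteq> 0" for i using gE[of i] E by metis
  have orth: "b i \<bullet> b j = (if i = j then 1 else 0)" for i j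
  proof (cases "i = j")
    case True then show ?thesis using gn by (simp add: b_def power2_norm_eq_inner[symmetric] power2_eq_square)
  next
    case False
    then have "g i \<noteq> g j" using g by (auto simp: bij_betw_def inj_on_def)
    then show ?thesis using E(1) gE False by (auto simp: b_def pairwise_def orthogonal_def)
  qed
  obtain i0 where i0: "g i0 = w" using g E(4) by (metis bij_betw_imp_surj_on imageE)
  have perp: "g i \<bullet> x = 0" if "g i \<notin> E1" "x \<in> R" for i x
  proof -
    have "orthogonal (g i) y" if "y \<in> E1" for y using E(1) gE[of i] that \<open>g i \<notin> E1\<close>
      by (metis E_def UnI1 pairwiseD)
    then show ?thesis using orthogonal_to_span[of x E1 "g i"] s1 that by (simp add: orthogonal_def)
  qed
  have bR: "b i \<in> R \<longleftrightarrow> g i \<in> E1" for i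
  proof
    assume "g i \<in> E1" then show "b i \<in> R" using s1 R by (auto simp: b_def intro!: subspace_scale intro: span_base)
  next
    assume "b i \<in> R"
    then have "norm (g i) *\<^sub>R b i \<in> R" using R by (simp add: subspace_scale)
    then have "g i \<in> R" using gn by (simp add: b_def)
    then show "g i \<in> E1" using perp[of i "g i"] gn by auto
  qed
  have "bij_betw g {i. b i \<in> R} E1"
    using g bR unfolding bij_betw_def by (auto simp: E_def inj_on_def image_iff)
  then have "card {i. b i \<in> R} = dim R" using c1 bij_betw_same_card by force
  then show thesis
    using that[of b i0] orth i0 perp bR by (auto simp: b_def)
qed

section \<open>Rotation invariance and Gaussian laws on the line\<close>

lemma nn_integral_swap:
  assumes "sigma_finite_measure M" "sigma_finite_measure N"
    and "case_prod f \<in> borel_measurable (M \<Otimes>\<^sub>M N)"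
  shows "(\<integral>\<^sup>+x. \<integral>\<^sup>+y. f x y \<partial>N \<partial>M) = (\<integral>\<^sup>+y. \<integral>\<^sup>+x. f x y \<partial>M \<partial>N)"
  using pair_sigma_finite.Fubini'[OF pair_sigma_finite.intro[OF assms(1,2)] assms(3)] by simp

lemma nn_integral_lborel_translate:
  fixes G :: "'a::euclidean_space \<Rightarrow> ennreal"
  assumes [measurable]: "G \<in> borel_measurable borel"
  shows "(\<integral>\<^sup>+x. G (c + x) \<partial>lborel) = (\<integral>\<^sup>+x. G x \<partial>lborel)"
  by (subst (2) lborel_distr_plus[of c, symmetric]) (simp add: nn_integral_distr)

text \<open>Writing \<open>f\<close> for the indicator of the unit ball, Fubini and translation invariance give
  \<open>\<integral>g \<cdot> \<integral>f = \<integral>\<integral> g(z) f(z - T y) = \<integral>\<integral> g(T y + z) f(z) = \<integral>f \<cdot> \<integral>g \<circ> T\<close>; only \<open>f \<circ> T = f\<close> is used, no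
  determinant.\<close>

lemma nn_integral_lborel_orthogonal:
  fixes T :: "'a::euclidean_space \<Rightarrow> 'a" and g :: "'a \<Rightarrow> ennreal"
  assumes T: "orthogonal_transformation T" and g[measurable]: "g \<in> borel_measurable borel"
  shows "(\<integral>\<^sup>+x. g (T x) \<partial>lborel) = (\<integral>\<^sup>+x. g x \<partial>lborel)"
proof -
  have lin: "linear T" using T by (rule orthogonal_transformation_linear)
  have [measurable]: "T \<in> borel_measurable borel"
    using lin by (intro borel_measurable_continuous_onI linear_continuous_on) (metis linear_conv_bounded_linear)
  have surj: "\<exists>q. z = T q" for z using orthogonal_transformation_surj[OF T] by (metis surjD)
  define f :: "'a \<Rightarrow> ennreal" where "f = indicator (ball 0 1)"
  have [measurable]: "f \<in> borel_measurable borel" unfolding f_def by (intro borel_measurable_indicator) auto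
  have fT: "f (- T y) = f y" for y
    using orthogonal_transformation_norm[OF T, of y] by (simp add: f_def indicator_def dist_norm)
  define c where "c = (\<integral>\<^sup>+x. f x \<partial>lborel)"
  have c: "c = emeasure lborel (ball (0::'a) 1)" by (simp add: c_def f_def)
  have "unit_ball_vol (real DIM('a)) \<noteq> 0" by (metis less_irrefl of_nat_0_le_iff unit_ball_vol_pos)
  then have "c \<noteq> 0" "c \<noteq> \<infinity>" by (simp_all add: c emeasure_ball)
  have 1: "(\<integral>\<^sup>+y. f (z - T y) \<partial>lborel) = c" for z
  proof -
    obtain q where q: "z = T q" using surj by blast
    have "(\<integral>\<^sup>+y. f (z - T y) \<partial>lborel) = (\<integral>\<^sup>+y. f (z - T (q + y)) \<partial>lborel)"
      by (rule nn_integral_lborel_translate[of "\<lambda>y. f (z - T y)" q, symmetric]) measurable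
    also have "\<dots> = c" by (simp add: q linear_add[OF lin] fT c_def)
    finally show ?thesis .
  qed
  have 2: "(\<integral>\<^sup>+y. g (T y + z) \<partial>lborel) = (\<integral>\<^sup>+y. g (T y) \<partial>lborel)" for z
  proof -
    obtain q where q: "z = T q" using surj by blast
    have "(\<integral>\<^sup>+y. g (T y + z) \<partial>lborel) = (\<integral>\<^sup>+y. g (T (q + y)) \<partial>lborel)"
      by (simp add: q linear_add[OF lin] add.commute)
    also have "\<dots> = (\<integral>\<^sup>+y. g (T y) \<partial>lborel)"
      by (rule nn_integral_lborel_translate[of "\<lambda>y. g (T y)" q]) measurable
    finally show ?thesis .
  qed
  have "c * (\<integral>\<^sup>+z. g z \<partial>lborel) = (\<integral>\<^sup>+z. g z * (\<integral>\<^sup>+y. f (z - T y) \<partial>lborel) \<partial>lborel)"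
    by (simp add: 1 nn_integral_multc mult.commute[of c])
  also have "\<dots> = (\<integral>\<^sup>+z. \<integral>\<^sup>+y. g z * f (z - T y) \<partial>lborel \<partial>lborel)"
    by (simp add: nn_integral_cmult)
  also have "\<dots> = (\<integral>\<^sup>+y. \<integral>\<^sup>+z. g z * f (z - T y) \<partial>lborel \<partial>lborel)"
    by (intro nn_integral_swap lborel.sigma_finite_measure_axioms) measurable
  also have "\<dots> = (\<integral>\<^sup>+y. \<integral>\<^sup>+z. g (T y + z) * f z \<partial>lborel \<partial>lborel)"
  proof (rule nn_integral_cong)
    fix y
    show "(\<integral>\<^sup>+z. g z * f (z - T y) \<partial>lborel) = (\<integral>\<^sup>+z. g (T y + z) * f z \<partial>lborel)"
      using nn_integral_lborel_translate[of "\<lambda>z. g z * f (z - T y)" "T y"] by simp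
  qed
  also have "\<dots> = (\<integral>\<^sup>+z. \<integral>\<^sup>+y. g (T y + z) * f z \<partial>lborel \<partial>lborel)"
    by (intro nn_integral_swap lborel.sigma_finite_measure_axioms) measurable
  also have "\<dots> = (\<integral>\<^sup>+y. g (T y) \<partial>lborel) * c"
    by (simp add: nn_integral_multc nn_integral_cmult 2 c_def)
  finally show ?thesis using \<open>c \<noteq> 0\<close> \<open>c \<noteq> \<infinity>\<close>
    by (simp add: mult.commute[of _ c] ennreal_mult_cancel_left)
qed

text \<open>Literally the factor with mean \<open>\<theta> i\<close> in
  \<open>noncentral_chi_square\<close>, whose product measure thus becomes a product of
  \<open>gauss\<close> measures.\<close>

definition gauss :: "real \<Rightarrow> real measure" where
  "gauss a = density lborel (\<lambda>x. ennreal (normal_density a 1 x))"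

lemma sets_gauss[simp, measurable_cong]: "sets (gauss a) = sets borel"
  by (simp add: gauss_def)

lemma space_gauss[simp]: "space (gauss a) = UNIV"
  by (simp add: gauss_def)

lemma prob_space_gauss: "prob_space (gauss a)"
  unfolding gauss_def by (rule prob_space_normal_density) simp

interpretation gauss: prob_space "gauss a" for a
  by (rule prob_space_gauss)

lemma sigma_finite_gauss: "sigma_finite_measure (gauss a)"
  by (intro prob_space_imp_sigma_finite prob_space_gauss)

lemma nn_integral_gauss:
  "g \<in> borel_measurable borel \<Longrightarrow>
    (\<integral>\<^sup>+x. g x \<partial>gauss a) = (\<integral>\<^sup>+x. ennreal (normal_density a 1 x) * g x \<partial>lborel)"
  unfolding gauss_def by (subst nn_integral_density) auto

lemma nn_integral_gauss_shift:
  assumes [measurable]: "g \<in> borel_measurable borel"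
  shows "(\<integral>\<^sup>+x. g (a + x) \<partial>gauss 0) = (\<integral>\<^sup>+x. g x \<partial>gauss a)"
proof -
  have "(\<integral>\<^sup>+x. ennreal (normal_density a 1 x) * g x \<partial>lborel)
      = (\<integral>\<^sup>+x. ennreal (normal_density a 1 (a + x)) * g (a + x) \<partial>lborel)"
    by (rule nn_integral_lborel_translate[symmetric]) measurable
  then show ?thesis by (simp add: nn_integral_gauss normal_density_def)
qed

lemma nn_integral_lborel_rotation:
  fixes F :: "real \<Rightarrow> real \<Rightarrow> ennreal"
  assumes c: "c\<^sup>2 + s\<^sup>2 = 1" and [measurable]: "case_prod F \<in> borel_measurable borel"
  shows "(\<integral>\<^sup>+x. \<integral>\<^sup>+y. F (c * x - s * y) (s * x + c * y) \<partial>lborel \<partial>lborel) = (\<integral>\<^sup>+x. \<integral>\<^sup>+y. F x y \<partial>lborel \<partial>lborel)"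
proof -
  define T :: "real \<times> real \<Rightarrow> real \<times> real" where "T p = (c * fst p - s * snd p, s * fst p + c * snd p)" for p
  have "T v \<bullet> T w = v \<bullet> w" for v w
  proof -
    have "T v \<bullet> T w = (c\<^sup>2 + s\<^sup>2) * (v \<bullet> w)"
      by (simp add: T_def inner_prod_def power2_eq_square algebra_simps)
    then show ?thesis using c by simp
  qed
  moreover have "linear T"
    by (rule linearI) (auto simp: T_def algebra_simps)
  ultimately have T: "orthogonal_transformation T" by (simp add: orthogonal_transformation_def)
  have [measurable]: "T \<in> borel_measurable borel"
    unfolding T_def borel_prod[symmetric] by measurable
  have m: "case_prod F \<in> borel_measurable (lborel \<Otimes>\<^sub>M lborel)" by (simp add: lborel_prod)
  have m': "(\<lambda>p. case_prod F (T p)) \<in> borel_measurable (lborel \<Otimes>\<^sub>M lborel)" by (simp add: lborel_prod)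
  have "(\<integral>\<^sup>+p. case_prod F (T p) \<partial>(lborel \<Otimes>\<^sub>M lborel)) = (\<integral>\<^sup>+p. case_prod F p \<partial>(lborel \<Otimes>\<^sub>M lborel))"
    unfolding lborel_prod by (rule nn_integral_lborel_orthogonal[OF T]) measurable
  then show ?thesis
    using lborel.nn_integral_fst[OF m] lborel.nn_integral_fst[OF m'] by (simp add: T_def)
qed

text \<open>The rotation that takes (r, 0) to the mean vector (a, b), where r^2 = a^2 + b^2,
  preserves Lebesgue measure and x^2 + y^2, so the whole mean can be moved into the first
  coordinate. This is why a noncentral chi-square law depends on its means only through the sum of
  their squares.\<close>

lemma gauss_pair_rotation:
  assumes [measurable]: "F \<in> borel_measurable borel"
  shows "(\<integral>\<^sup>+x. \<integral>\<^sup>+y. F (x\<^sup>2 + y\<^sup>2) \<partial>gauss b \<partial>gauss a)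
    = (\<integral>\<^sup>+x. \<integral>\<^sup>+y. F (x\<^sup>2 + y\<^sup>2) \<partial>gauss 0 \<partial>gauss (sqrt (a\<^sup>2 + b\<^sup>2)))"
proof -
  define r where "r = sqrt (a\<^sup>2 + b\<^sup>2)"
  have r2: "r\<^sup>2 = a\<^sup>2 + b\<^sup>2" by (simp add: r_def)
  define G where "G a b x y = ennreal (normal_density a 1 x) * (ennreal (normal_density b 1 y) * F (x\<^sup>2 + y\<^sup>2))"
    for a b x y :: real
  have [measurable]: "case_prod (G a b) \<in> borel_measurable borel" for a b
    unfolding G_def borel_prod[symmetric] by measurable
  have G: "(\<integral>\<^sup>+x. \<integral>\<^sup>+y. F (x\<^sup>2 + y\<^sup>2) \<partial>gauss b \<partial>gauss a) = (\<integral>\<^sup>+x. \<integral>\<^sup>+y. G a b x y \<partial>lborel \<partial>lborel)" for a b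
    by (simp add: nn_integral_gauss nn_integral_cmult G_def)
  show ?thesis
  proof (cases "r = 0")
    case True
    then have "a = 0" "b = 0" using r2 by (auto simp: sum_power2_eq_zero_iff)
    then show ?thesis by simp
  next
    case False
    define c where "c = a / r"
    define s where "s = b / r"
    have "c\<^sup>2 + s\<^sup>2 = (a\<^sup>2 + b\<^sup>2) / r\<^sup>2"
      by (simp add: c_def s_def power_divide add_divide_distrib)
    then have cs: "c\<^sup>2 + s\<^sup>2 = 1" unfolding r2[symmetric] using False by simp
    have ab: "a = c * r" "b = s * r" using False by (auto simp: c_def s_def)
    have "G a b (c * x - s * y) (s * x + c * y) = G r 0 x y" for x y
    proof -
      have n: "(c * x - s * y)\<^sup>2 + (s * x + c * y)\<^sup>2 = x\<^sup>2 + y\<^sup>2" (is "?u\<^sup>2 + ?v\<^sup>2 = _")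
      proof -
        have "?u\<^sup>2 + ?v\<^sup>2 = (c\<^sup>2 + s\<^sup>2) * (x\<^sup>2 + y\<^sup>2)" by (simp add: power2_eq_square algebra_simps)
        then show ?thesis using cs by simp
      qed
      have "(?u - a)\<^sup>2 + (?v - b)\<^sup>2 = (c\<^sup>2 + s\<^sup>2) * ((x - r)\<^sup>2 + y\<^sup>2)"
        unfolding ab by (simp add: power2_eq_square algebra_simps)
      then have "exp (- (?u - a)\<^sup>2 / 2) * exp (- (?v - b)\<^sup>2 / 2) = exp (- (x - r)\<^sup>2 / 2) * exp (- y\<^sup>2 / 2)"
        using cs by (simp add: mult_exp_exp flip: add_divide_distrib)
      then have "normal_density a 1 ?u * normal_density b 1 ?v = normal_density r 1 x * normal_density 0 1 y"
        by (simp add: normal_density_def)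
      then show ?thesis
        by (simp add: G_def n mult.assoc[symmetric] ennreal_mult[symmetric])
    qed
    then show ?thesis
      using nn_integral_lborel_rotation[OF cs, of "G a b"] by (simp add: G r_def)
  qed
qed

section \<open>Quadratic changes of variables and sums of squared Gaussians\<close>

lemma nn_integral_square_substitution:
  assumes [measurable]: "F \<in> borel_measurable borel"
  shows "(\<integral>\<^sup>+u. ennreal u * F (u\<^sup>2) \<partial>lborel) = (\<integral>\<^sup>+s. indicator {0..} s * ennreal (1 / 2) * F s \<partial>lborel)"
proof -
  have ind: "(SUP n::nat. indicator {0..real n} (x::real)) = (indicator {0..} x :: ennreal)" for x
  proof (rule antisym)
    show "(SUP n::nat. indicator {0..real n} x) \<le> (indicator {0..} x :: ennreal)"
      by (intro SUP_least) (auto simp: indicator_def)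
    obtain n :: nat where "x \<le> n" using real_arch_simple by blast
    then show "(indicator {0..} x :: ennreal) \<le> (SUP n::nat. indicator {0..real n} x)"
      by (intro SUP_upper2[of n]) (auto simp: indicator_def)
  qed
  have ind2: "(SUP n::nat. indicator {0..(real n)\<^sup>2} (x::real)) = (indicator {0..} x :: ennreal)" for x
  proof (rule antisym)
    show "(SUP n::nat. indicator {0..(real n)\<^sup>2} x) \<le> (indicator {0..} x :: ennreal)"
      by (intro SUP_least) (auto simp: indicator_def)
    obtain n :: nat where "max 1 x \<le> n" using real_arch_simple by blast
    then have "x \<le> real n * 1" "real n * 1 \<le> (real n)\<^sup>2" by (auto simp: power2_eq_square)
    then have "x \<le> (real n)\<^sup>2" by linarith
    then show "(indicator {0..} x :: ennreal) \<le> (SUP n::nat. indicator {0..(real n)\<^sup>2} x)"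
      by (intro SUP_upper2[of n]) (auto simp: indicator_def)
  qed
  have half: "ennreal (1 / 2) * ennreal (2 * x) = ennreal x" for x :: real
    by (subst ennreal_mult'[symmetric]) auto
  \<comment> \<open>The substitution s = u^2 is made on [0, n], whose image is [0, n^2], and
    monotone convergence lets n grow. Negative u contribute nothing because \<open>ennreal u\<close>
    is 0 there, which leaves the factor 1/2 of a single branch of the square root.\<close>
  have step: "(\<integral>\<^sup>+x. F x * ennreal (1/2) * indicator {0..(real n)\<^sup>2} x \<partial>lborel)
      = (\<integral>\<^sup>+x. F (x\<^sup>2) * ennreal x * indicator {0..real n} x \<partial>lborel)" for n :: nat
  proof (cases "n = 0")
    case True
    then show ?thesis
      by (simp add: nn_integral_null_set[of "{0}"] flip: indicator_def)
  next
    case False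
    have "(\<integral>\<^sup>+x. (F x * ennreal (1/2)) * indicator {0\<^sup>2..(real n)\<^sup>2} x \<partial>lborel)
       = (\<integral>\<^sup>+x. (F (x\<^sup>2) * ennreal (1/2)) * ennreal (2 * x) * indicator {0..real n} x \<partial>lborel)"
      by (rule nn_integral_substitution_aux[where g = "\<lambda>x. x\<^sup>2"])
        (use False in \<open>auto intro!: derivative_eq_intros continuous_intros\<close>)
    also have "\<dots> = (\<integral>\<^sup>+x. F (x\<^sup>2) * ennreal x * indicator {0..real n} x \<partial>lborel)"
      by (intro nn_integral_cong) (metis half mult.assoc)
    finally show ?thesis by simp
  qed
  have "(\<integral>\<^sup>+u. ennreal u * F (u\<^sup>2) \<partial>lborel) = (\<integral>\<^sup>+u. (SUP n::nat. F (u\<^sup>2) * ennreal u * indicator {0..real n} u) \<partial>lborel)"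
    by (intro nn_integral_cong, subst SUP_mult_left_ennreal[symmetric], subst ind)
      (auto simp: indicator_def mult.commute ennreal_neg)
  also have "\<dots> = (SUP n::nat. \<integral>\<^sup>+u. F (u\<^sup>2) * ennreal u * indicator {0..real n} u \<partial>lborel)"
    by (intro nn_integral_monotone_convergence_SUP)
       (auto simp: incseq_def le_fun_def intro!: mult_left_mono split: split_indicator)
  also have "\<dots> = (SUP n::nat. \<integral>\<^sup>+x. F x * ennreal (1/2) * indicator {0..(real n)\<^sup>2} x \<partial>lborel)"
    by (simp only: step)
  also have "\<dots> = (\<integral>\<^sup>+x. (SUP n::nat. F x * ennreal (1/2) * indicator {0..(real n)\<^sup>2} x) \<partial>lborel)"
    by (intro nn_integral_monotone_convergence_SUP[symmetric])
       (auto simp: incseq_def le_fun_def intro!: mult_left_mono split: split_indicator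
          intro: order_trans power_mono)
  also have "\<dots> = (\<integral>\<^sup>+s. indicator {0..} s * ennreal (1 / 2) * F s \<partial>lborel)"
    by (intro nn_integral_cong, subst SUP_mult_left_ennreal[symmetric]) (auto simp: ind2 mult_ac)
  finally show ?thesis .
qed

lemma nn_integral_lborel_reflect:
  assumes [measurable]: "(g :: real \<Rightarrow> ennreal) \<in> borel_measurable borel"
  shows "(\<integral>\<^sup>+x. g (- x) \<partial>lborel) = (\<integral>\<^sup>+x. g x \<partial>lborel)"
  using nn_integral_real_affine[OF assms, of "-1" 0] by simp

text \<open>Each of the two branches of the square root contributes one half.\<close>

lemma nn_integral_abs_square_substitution:
  assumes [measurable]: "F \<in> borel_measurable borel"
  shows "(\<integral>\<^sup>+u. ennreal \<bar>u\<bar> * F (u\<^sup>2) \<partial>lborel) = (\<integral>\<^sup>+s. indicator {0..} s * F s \<partial>lborel)"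
proof -
  have half: "ennreal (1 / 2) * x + ennreal (1 / 2) * x = x" for x
    by (subst distrib_right[symmetric], subst ennreal_plus[symmetric]) auto
  have "(\<integral>\<^sup>+u. ennreal \<bar>u\<bar> * F (u\<^sup>2) \<partial>lborel)
      = (\<integral>\<^sup>+u. ennreal u * F (u\<^sup>2) + ennreal (- u) * F (u\<^sup>2) \<partial>lborel)"
    by (intro nn_integral_cong) (auto simp: abs_if ennreal_neg)
  also have "\<dots> = (\<integral>\<^sup>+u. ennreal u * F (u\<^sup>2) \<partial>lborel) + (\<integral>\<^sup>+u. ennreal (- u) * F (u\<^sup>2) \<partial>lborel)"
    by (rule nn_integral_add) auto
  also have "(\<integral>\<^sup>+u. ennreal (- u) * F (u\<^sup>2) \<partial>lborel) = (\<integral>\<^sup>+u. ennreal u * F (u\<^sup>2) \<partial>lborel)"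
    using nn_integral_lborel_reflect[of "\<lambda>u. ennreal u * F (u\<^sup>2)"] by simp
  also have "(\<integral>\<^sup>+u. ennreal u * F (u\<^sup>2) \<partial>lborel) + (\<integral>\<^sup>+u. ennreal u * F (u\<^sup>2) \<partial>lborel)
      = (\<integral>\<^sup>+s. indicator {0..} s * ennreal (1 / 2) * F s + indicator {0..} s * ennreal (1 / 2) * F s \<partial>lborel)"
    by (simp add: nn_integral_square_substitution nn_integral_add)
  also have "\<dots> = (\<integral>\<^sup>+s. indicator {0..} s * F s \<partial>lborel)"
    by (intro nn_integral_cong) (metis half distrib_left mult.assoc)
  finally show ?thesis .
qed

text \<open>Substituting \<open>z = t y\<close> separates the integral into one over \<open>t\<close> and one over \<open>y\<^sup>2\<close>; the former is the
  same for all \<open>F\<close>, so its value is read off the total mass.\<close>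

lemma gauss_pair_exponential:
  assumes F[measurable]: "F \<in> borel_measurable borel"
  shows "(\<integral>\<^sup>+y. \<integral>\<^sup>+z. F (y\<^sup>2 + z\<^sup>2) \<partial>gauss 0 \<partial>gauss 0)
    = (\<integral>\<^sup>+s. ennreal (exponential_density (1/2) s) * F s \<partial>lborel)"
proof -
  define J where "J = (\<integral>\<^sup>+t. ennreal (1 / (pi * (1 + t\<^sup>2))) \<partial>lborel)"
  have pos: "1 + t\<^sup>2 > 0" for t :: real by (rule add_pos_nonneg) auto
  have gen: "(\<integral>\<^sup>+y. \<integral>\<^sup>+z. F (y\<^sup>2 + z\<^sup>2) \<partial>gauss 0 \<partial>gauss 0)
    = J * (\<integral>\<^sup>+s. ennreal (exponential_density (1/2) s) * F s \<partial>lborel)"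
    if [measurable]: "F \<in> borel_measurable borel" for F
  proof -
    \<comment> \<open>\<open>P\<close> absorbs the joint density of the two coordinates, which
      depends on y^2 + z^2 only.\<close>
    define P where "P s = ennreal (exp (- s / 2) / (2 * pi)) * F s" for s
    have [measurable]: "P \<in> borel_measurable borel" unfolding P_def by measurable
    have "(\<integral>\<^sup>+y. \<integral>\<^sup>+z. F (y\<^sup>2 + z\<^sup>2) \<partial>gauss 0 \<partial>gauss 0) = (\<integral>\<^sup>+y. \<integral>\<^sup>+z. P (y\<^sup>2 + z\<^sup>2) \<partial>lborel \<partial>lborel)"
    proof -
      have e: "ennreal (normal_density 0 1 y) * (ennreal (normal_density 0 1 z) * F (y\<^sup>2 + z\<^sup>2)) = P (y\<^sup>2 + z\<^sup>2)" for y z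
      proof -
        have "normal_density 0 1 y * normal_density 0 1 z = exp (- (y\<^sup>2 + z\<^sup>2) / 2) / (2 * pi)"
          by (simp add: normal_density_def exp_add[symmetric] add_divide_distrib)
        then show ?thesis by (simp add: P_def mult.assoc[symmetric] ennreal_mult[symmetric])
      qed
      show ?thesis by (simp add: nn_integral_gauss nn_integral_cmult[symmetric] e)
    qed
    also have "\<dots> = (\<integral>\<^sup>+y. \<integral>\<^sup>+t. ennreal \<bar>y\<bar> * P (y\<^sup>2 * (1 + t\<^sup>2)) \<partial>lborel \<partial>lborel)"
    proof (intro nn_integral_cong_AE)
      \<comment> \<open>The substitution z = y t degenerates only on the null set y = 0.\<close>
      have "AE y in lborel. y \<noteq> (0::real)" by (rule AE_lborel_singleton)
      then show "AE y in lborel. (\<integral>\<^sup>+z. P (y\<^sup>2 + z\<^sup>2) \<partial>lborel) = (\<integral>\<^sup>+t. ennreal \<bar>y\<bar> * P (y\<^sup>2 * (1 + t\<^sup>2)) \<partial>lborel)"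
      proof eventually_elim
        case (elim y)
        have "(\<integral>\<^sup>+z. P (y\<^sup>2 + z\<^sup>2) \<partial>lborel) = ennreal \<bar>y\<bar> * (\<integral>\<^sup>+t. P (y\<^sup>2 + (0 + y * t)\<^sup>2) \<partial>lborel)"
          using elim by (intro nn_integral_real_affine) auto
        also have "\<dots> = (\<integral>\<^sup>+t. ennreal \<bar>y\<bar> * P (y\<^sup>2 * (1 + t\<^sup>2)) \<partial>lborel)"
          by (subst nn_integral_cmult[symmetric]) (auto simp: power_mult_distrib algebra_simps)
        finally show ?case .
      qed
    qed
    also have "\<dots> = (\<integral>\<^sup>+t. \<integral>\<^sup>+y. ennreal \<bar>y\<bar> * P (y\<^sup>2 * (1 + t\<^sup>2)) \<partial>lborel \<partial>lborel)"
      by (intro nn_integral_swap lborel.sigma_finite_measure_axioms) measurable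
    also have "\<dots> = (\<integral>\<^sup>+t. \<integral>\<^sup>+s. indicator {0..} s * P (s * (1 + t\<^sup>2)) \<partial>lborel \<partial>lborel)"
      by (intro nn_integral_cong nn_integral_abs_square_substitution[where F = "\<lambda>s. P (s * (1 + t\<^sup>2))" for t]) measurable
    also have "\<dots> = (\<integral>\<^sup>+t. ennreal (1 / (1 + t\<^sup>2)) * (\<integral>\<^sup>+s. indicator {0..} s * P s \<partial>lborel) \<partial>lborel)"
    proof (intro nn_integral_cong)
      fix t :: real
      let ?c = "1 + t\<^sup>2"
      have "(\<integral>\<^sup>+s. indicator {0..} s * P s \<partial>lborel)
         = ennreal \<bar>?c\<bar> * (\<integral>\<^sup>+s. indicator {0..} (0 + ?c * s) * P (0 + ?c * s) \<partial>lborel)"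
        using pos[of t] by (intro nn_integral_real_affine) auto
      also have "(\<lambda>s. indicator {0..} (0 + ?c * s) * P (0 + ?c * s)) = (\<lambda>s. indicator {0..} s * P (s * ?c))"
        using pos[of t] by (auto simp: indicator_def zero_le_mult_iff mult.commute fun_eq_iff)
      finally have "ennreal (1 / ?c) * (\<integral>\<^sup>+s. indicator {0..} s * P s \<partial>lborel)
        = (ennreal (1 / ?c) * ennreal ?c) * (\<integral>\<^sup>+s. indicator {0..} s * P (s * ?c) \<partial>lborel)"
        using pos[of t] by (simp add: mult.assoc)
      also have "ennreal (1 / ?c) * ennreal ?c = 1"
        using pos[of t] by (subst ennreal_mult[symmetric]) auto
      finally show "(\<integral>\<^sup>+s. indicator {0..} s * P (s * ?c) \<partial>lborel)
        = ennreal (1 / ?c) * (\<integral>\<^sup>+s. indicator {0..} s * P s \<partial>lborel)" by simp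
    qed
    also have "\<dots> = (\<integral>\<^sup>+t. ennreal (1 / (1 + t\<^sup>2)) \<partial>lborel) * (\<integral>\<^sup>+s. indicator {0..} s * P s \<partial>lborel)"
      by (rule nn_integral_multc) measurable
    \<comment> \<open>The density inside \<open>P\<close> is 1/pi times the exponential density of
      rate 1/2; that 1/pi completes the Cauchy density in \<open>J\<close>.\<close>
    also have "(\<integral>\<^sup>+s. indicator {0..} s * P s \<partial>lborel)
        = (\<integral>\<^sup>+s. ennreal (1 / pi) * (ennreal (exponential_density (1/2) s) * F s) \<partial>lborel)"
      by (intro nn_integral_cong)
        (auto simp: P_def indicator_def exponential_density_def mult.assoc[symmetric] ennreal_mult[symmetric])
    also have "\<dots> = ennreal (1 / pi) * (\<integral>\<^sup>+s. ennreal (exponential_density (1/2) s) * F s \<partial>lborel)"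
      by (rule nn_integral_cmult) measurable
    also have "(\<integral>\<^sup>+t. ennreal (1 / (1 + t\<^sup>2)) \<partial>lborel) * (ennreal (1 / pi) * (\<integral>\<^sup>+s. ennreal (exponential_density (1/2) s) * F s \<partial>lborel))
      = J * (\<integral>\<^sup>+s. ennreal (exponential_density (1/2) s) * F s \<partial>lborel)"
      unfolding J_def mult.assoc[symmetric]
      by (subst nn_integral_multc[symmetric])
        (auto simp: ennreal_mult[symmetric] pos[THEN less_imp_le] mult.commute)
    finally show ?thesis .
  qed
  have "(\<integral>\<^sup>+s. ennreal (exponential_density (1/2) s) * 1 \<partial>lborel) = 1"
    using prob_space.emeasure_space_1[OF prob_space_exponential_density[of "1/2"]] by (simp add: emeasure_density)
  then have "J = 1"
    using gen[of "\<lambda>_. 1"] prob_space.emeasure_space_1[OF prob_space_gauss] by simp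
  then show ?thesis using gen[OF F] by simp
qed

text \<open>By \<open>gauss_pair_exponential\<close> the two central squares have an exponential law
  of rate 1/2, so the density of the sum at \<open>s\<close> is an integral over x^2 \<le> s in
  which exp(x^2 / 2) cancels the quadratic term of the Gaussian density. What is left, exp(d x), has
  the antiderivative exp(d x) / d; the factor \<open>d\<close> in front clears that denominator, and
  the two end points give the difference of densities.\<close>

lemma gauss_triple_exponential:
  assumes F[measurable]: "F \<in> borel_measurable borel" and "d > 0"
  shows "ennreal d * (\<integral>\<^sup>+x. \<integral>\<^sup>+y. \<integral>\<^sup>+z. F (x\<^sup>2 + (y\<^sup>2 + z\<^sup>2)) \<partial>gauss 0 \<partial>gauss 0 \<partial>gauss d)
    = (\<integral>\<^sup>+s. indicator {0..} s * ennreal ((normal_density d 1 (sqrt s) - normal_density d 1 (- sqrt s)) / 2) * F s \<partial>lborel)"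
proof -
  let ?e = "exponential_density (1 / 2)"
  have inner: "(\<integral>\<^sup>+y. \<integral>\<^sup>+z. F (x\<^sup>2 + (y\<^sup>2 + z\<^sup>2)) \<partial>gauss 0 \<partial>gauss 0)
      = (\<integral>\<^sup>+s. ennreal (?e (s - x\<^sup>2)) * F s \<partial>lborel)" for x
  proof -
    have "(\<integral>\<^sup>+y. \<integral>\<^sup>+z. F (x\<^sup>2 + (y\<^sup>2 + z\<^sup>2)) \<partial>gauss 0 \<partial>gauss 0) = (\<integral>\<^sup>+s. ennreal (?e s) * F (x\<^sup>2 + s) \<partial>lborel)"
      by (rule gauss_pair_exponential[of "\<lambda>s. F (x\<^sup>2 + s)"]) measurable
    also have "\<dots> = (\<integral>\<^sup>+s. ennreal (?e (s - x\<^sup>2)) * F s \<partial>lborel)"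
      using nn_integral_lborel_translate[of "\<lambda>s. ennreal (?e (s - x\<^sup>2)) * F s" "x\<^sup>2"] by simp
    finally show ?thesis .
  qed
  have fiber: "ennreal d * (\<integral>\<^sup>+x. ennreal (normal_density d 1 x) * ennreal (?e (s - x\<^sup>2)) \<partial>lborel)
      = indicator {0..} s * ennreal ((normal_density d 1 (sqrt s) - normal_density d 1 (- sqrt s)) / 2)" for s
  proof (cases "s \<ge> 0")
    case False
    have "s - x\<^sup>2 < 0" for x using False zero_le_power2[of x] by linarith
    then have "?e (s - x\<^sup>2) = 0" for x by (simp add: exponential_density_def)
    then show ?thesis using False by simp
  next
    case True
    define K where "K = 1 / sqrt (2 * pi) * (1 / 2) * exp (- s / 2 - d\<^sup>2 / 2)"
    have K: "K \<ge> 0" by (simp add: K_def)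
    have Kn: "K * exp (d * x) = normal_density d 1 x / 2" if "x\<^sup>2 = s" for x
    proof -
      have "exp (- (x - d)\<^sup>2 / 2) = exp (- s / 2 - d\<^sup>2 / 2) * exp (d * x)"
        unfolding mult_exp_exp that[symmetric] by (simp add: power2_eq_square field_simps)
      then show ?thesis by (simp add: normal_density_def K_def)
    qed
    have supp: "s - x\<^sup>2 < 0 \<longleftrightarrow> x \<notin> {- sqrt s..sqrt s}" for x
    proof -
      have "x \<in> {- sqrt s..sqrt s} \<longleftrightarrow> sqrt (x\<^sup>2) \<le> sqrt s" by (auto simp: abs_le_iff)
      then show ?thesis unfolding real_sqrt_le_iff by auto
    qed
    have "normal_density d 1 x * ?e (s - x\<^sup>2) = K * exp (d * x) * indicator {- sqrt s..sqrt s} x" for x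
    proof (cases "x \<in> {- sqrt s..sqrt s}")
      case False
      then show ?thesis using supp[of x] by (simp add: exponential_density_def)
    next
      case xin: True
      have "exp (- (x - d)\<^sup>2 / 2) * exp (- (s - x\<^sup>2) / 2) = exp (- s / 2 - d\<^sup>2 / 2) * exp (d * x)"
        unfolding mult_exp_exp by (simp add: power2_eq_square field_simps)
      then show ?thesis using xin supp[of x]
        by (simp add: exponential_density_def normal_density_def K_def)
    qed
    then have "(\<integral>\<^sup>+x. ennreal (normal_density d 1 x) * ennreal (?e (s - x\<^sup>2)) \<partial>lborel)
      = (\<integral>\<^sup>+x. ennreal (K * exp (d * x)) * indicator {- sqrt s..sqrt s} x \<partial>lborel)"
      using K by (intro nn_integral_cong) (auto simp: ennreal_mult[symmetric] indicator_def exponential_density_nonneg)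
    also have "\<dots> = ennreal (K / d * exp (d * sqrt s) - K / d * exp (d * (- sqrt s)))"
      using \<open>d > 0\<close> K True
      by (intro nn_integral_FTC_Icc[where F = "\<lambda>x. K / d * exp (d * x)"])
        (auto intro!: derivative_eq_intros)
    also have "ennreal d * \<dots> = ennreal (K * exp (d * sqrt s) - K * exp (d * (- sqrt s)))"
      using \<open>d > 0\<close> by (subst ennreal_mult'[symmetric]) (auto simp: right_diff_distrib)
    also have "K * exp (d * sqrt s) - K * exp (d * (- sqrt s))
       = (normal_density d 1 (sqrt s) - normal_density d 1 (- sqrt s)) / 2"
      using Kn[of "sqrt s"] Kn[of "- sqrt s"] True by (simp add: diff_divide_distrib)
    finally show ?thesis using True by simp
  qed
  have "(\<integral>\<^sup>+x. \<integral>\<^sup>+y. \<integral>\<^sup>+z. F (x\<^sup>2 + (y\<^sup>2 + z\<^sup>2)) \<partial>gauss 0 \<partial>gauss 0 \<partial>gauss d)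
      = (\<integral>\<^sup>+x. ennreal (normal_density d 1 x) * (\<integral>\<^sup>+s. ennreal (?e (s - x\<^sup>2)) * F s \<partial>lborel) \<partial>lborel)"
    unfolding inner by (rule nn_integral_gauss) measurable
  also have "\<dots> = (\<integral>\<^sup>+x. \<integral>\<^sup>+s. ennreal (normal_density d 1 x) * (ennreal (?e (s - x\<^sup>2)) * F s) \<partial>lborel \<partial>lborel)"
    by (simp add: nn_integral_cmult)
  also have "\<dots> = (\<integral>\<^sup>+s. \<integral>\<^sup>+x. ennreal (normal_density d 1 x) * (ennreal (?e (s - x\<^sup>2)) * F s) \<partial>lborel \<partial>lborel)"
    by (intro nn_integral_swap lborel.sigma_finite_measure_axioms) measurable
  also have "\<dots> = (\<integral>\<^sup>+s. (\<integral>\<^sup>+x. ennreal (normal_density d 1 x) * ennreal (?e (s - x\<^sup>2)) \<partial>lborel) * F s \<partial>lborel)"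
    by (simp add: nn_integral_multc mult.assoc[symmetric])
  also have "ennreal d * \<dots> = (\<integral>\<^sup>+s. (ennreal d * (\<integral>\<^sup>+x. ennreal (normal_density d 1 x) * ennreal (?e (s - x\<^sup>2)) \<partial>lborel)) * F s \<partial>lborel)"
    by (subst nn_integral_cmult[symmetric]) (auto simp: mult.assoc)
  finally show ?thesis by (simp only: fiber)
qed

text \<open>The radial density at \<open>r\<close> of a unit-variance Gaussian vector in dimension 3 with mean of norm \<open>d\<close>
  is \<open>r (\<phi>(r - d) - \<phi>(r + d)) / d\<close>, which is what folding \<open>x \<phi>(x - d)\<close> at the origin gives, up to \<open>d\<close>.
  The negative part is moved to the right-hand side to stay within the extended nonnegative reals.\<close>

lemma gauss_first_moment_eq_triple:
  assumes F[measurable]: "F \<in> borel_measurable borel" and d: "d > 0"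
  shows "(\<integral>\<^sup>+x. ennreal x * F (x\<^sup>2) \<partial>gauss d)
    = (\<integral>\<^sup>+x. ennreal (- x) * F (x\<^sup>2) \<partial>gauss d)
      + ennreal d * (\<integral>\<^sup>+x. \<integral>\<^sup>+y. \<integral>\<^sup>+z. F (x\<^sup>2 + (y\<^sup>2 + z\<^sup>2)) \<partial>gauss 0 \<partial>gauss 0 \<partial>gauss d)"
proof -
  \<comment> \<open>The mean \<open>a\<close> is left general because the negative half line is
    reflected onto the positive one, which changes the mean from d to -d.\<close>
  have half: "(\<integral>\<^sup>+x. ennreal x * (ennreal (normal_density a 1 x) * F (x\<^sup>2)) \<partial>lborel)
      = (\<integral>\<^sup>+s. indicator {0..} s * ennreal (normal_density a 1 (sqrt s) / 2) * F s \<partial>lborel)" for a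
  proof -
    have "(\<integral>\<^sup>+x. ennreal x * (ennreal (normal_density a 1 x) * F (x\<^sup>2)) \<partial>lborel)
      = (\<integral>\<^sup>+x. ennreal x * (ennreal (normal_density a 1 (sqrt (x\<^sup>2))) * F (x\<^sup>2)) \<partial>lborel)"
      by (intro nn_integral_cong) (auto simp: abs_if ennreal_neg)
    also have "\<dots> = (\<integral>\<^sup>+s. indicator {0..} s * ennreal (1 / 2) * (ennreal (normal_density a 1 (sqrt s)) * F s) \<partial>lborel)"
      by (rule nn_integral_square_substitution) measurable
    also have "\<dots> = (\<integral>\<^sup>+s. indicator {0..} s * ennreal (normal_density a 1 (sqrt s) / 2) * F s \<partial>lborel)"
    proof -
      have "ennreal (1 / 2) * ennreal (normal_density a 1 t) = ennreal (normal_density a 1 t / 2)" for t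
        by (subst ennreal_mult'[symmetric]) auto
      then show ?thesis by (intro nn_integral_cong) (metis mult.assoc)
    qed
    finally show ?thesis .
  qed
  have refl: "normal_density d 1 (- x) = normal_density (- d) 1 x" for x
    by (simp add: normal_density_def power2_eq_square algebra_simps)
  have pos: "(\<integral>\<^sup>+x. ennreal x * F (x\<^sup>2) \<partial>gauss d)
      = (\<integral>\<^sup>+s. indicator {0..} s * ennreal (normal_density d 1 (sqrt s) / 2) * F s \<partial>lborel)"
    by (simp add: nn_integral_gauss half[symmetric] mult.left_commute)
  have neg: "(\<integral>\<^sup>+x. ennreal (- x) * F (x\<^sup>2) \<partial>gauss d)
      = (\<integral>\<^sup>+s. indicator {0..} s * ennreal (normal_density d 1 (- sqrt s) / 2) * F s \<partial>lborel)"
  proof -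
    have "(\<integral>\<^sup>+x. ennreal (- x) * F (x\<^sup>2) \<partial>gauss d)
        = (\<integral>\<^sup>+x. ennreal (- x) * (ennreal (normal_density (- d) 1 (- x)) * F (x\<^sup>2)) \<partial>lborel)"
      by (simp add: nn_integral_gauss mult.left_commute refl[symmetric])
    also have "\<dots> = (\<integral>\<^sup>+x. ennreal x * (ennreal (normal_density (- d) 1 x) * F (x\<^sup>2)) \<partial>lborel)"
      using nn_integral_lborel_reflect[of "\<lambda>x. ennreal x * (ennreal (normal_density (- d) 1 x) * F (x\<^sup>2))"] by simp
    finally show ?thesis by (simp add: half refl)
  qed
  \<comment> \<open>Here d > 0 enters: sqrt s is at least as close to d as - sqrt s is, so the
    difference of densities is nonnegative and \<open>ennreal\<close> does not truncate it.\<close>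
  have "ennreal (normal_density d 1 (sqrt s) / 2) = ennreal (normal_density d 1 (- sqrt s) / 2)
      + ennreal ((normal_density d 1 (sqrt s) - normal_density d 1 (- sqrt s)) / 2)" if "s \<ge> 0" for s
  proof -
    have "(sqrt s - d)\<^sup>2 \<le> (- sqrt s - d)\<^sup>2" using that d by (simp add: power2_eq_square algebra_simps)
    then have "normal_density d 1 (- sqrt s) \<le> normal_density d 1 (sqrt s)"
      by (simp add: normal_density_def mult_left_mono divide_right_mono)
    then show ?thesis by (subst ennreal_plus[symmetric]) (auto simp: field_simps)
  qed
  then have "indicator {0..} s * ennreal (normal_density d 1 (sqrt s) / 2) * F s
    = indicator {0..} s * ennreal (normal_density d 1 (- sqrt s) / 2) * F s
      + indicator {0..} s * ennreal ((normal_density d 1 (sqrt s) - normal_density d 1 (- sqrt s)) / 2) * F s" for s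
    by (cases "s \<ge> 0") (simp_all only: indicator_simps atLeast_iff mult_1 mult_zero_left add_0 distrib_right not_False_eq_True)
  then show ?thesis
    unfolding pos neg gauss_triple_exponential[OF F d]
    by (subst nn_integral_add[symmetric]) (auto simp del: ennreal_plus)
qed

section \<open>Chi-square laws\<close>

text \<open>The central law as an iterated convolution, so that splitting off one square is the
  defining equation. Zero degrees of freedom give the point mass at 0, which is the law of
  \<open>R\<close> when k = 1.\<close>

primrec chi_square :: "nat \<Rightarrow> real measure" where
  "chi_square 0 = return borel 0"
| "chi_square (Suc n) = distr (gauss 0 \<Otimes>\<^sub>M chi_square n) borel (\<lambda>(x, s). x\<^sup>2 + s)"

lemma sets_chi_square[simp, measurable_cong]: "sets (chi_square n) = sets borel"
  by (cases n) simp_all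

lemma space_chi_square[simp]: "space (chi_square n) = UNIV"
  by (cases n) simp_all

lemma prob_space_chi_square: "prob_space (chi_square n)"
proof (induction n)
  case 0
  then show ?case by (simp add: prob_space_return)
next
  case (Suc n)
  interpret P: pair_prob_space "gauss 0" "chi_square n"
    by (intro pair_prob_space.intro pair_sigma_finite.intro prob_space_imp_sigma_finite prob_space_gauss Suc)
  show ?case by (simp, rule P.prob_space_distr) measurable
qed

interpretation chi_square: prob_space "chi_square n" for n
  by (rule prob_space_chi_square)

lemma sigma_finite_chi_square: "sigma_finite_measure (chi_square n)"
  by (intro prob_space_imp_sigma_finite prob_space_chi_square)

lemma nn_integral_chi_square_Suc:
  assumes [measurable]: "F \<in> borel_measurable borel"
  shows "(\<integral>\<^sup>+s. F s \<partial>chi_square (Suc n)) = (\<integral>\<^sup>+x. \<integral>\<^sup>+s. F (x\<^sup>2 + s) \<partial>chi_square n \<partial>gauss 0)"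
  by (simp add: nn_integral_distr sigma_finite_measure.nn_integral_fst[OF sigma_finite_chi_square, symmetric])

abbreviation gauss_chi :: "real \<Rightarrow> nat \<Rightarrow> (real \<times> real) measure" where
  "gauss_chi a n \<equiv> gauss a \<Otimes>\<^sub>M chi_square n"

lemma nn_integral_gauss_chi:
  assumes "case_prod F \<in> borel_measurable borel"
  shows "(\<integral>\<^sup>+p. case_prod F p \<partial>gauss_chi a n) = (\<integral>\<^sup>+x. \<integral>\<^sup>+s. F x s \<partial>chi_square n \<partial>gauss a)"
proof -
  have "case_prod F \<in> borel_measurable (gauss_chi a n)"
    using assms by (simp add: borel_prod[symmetric] cong: measurable_cong_sets)
  then show ?thesis
    by (simp add: sigma_finite_measure.nn_integral_fst[OF sigma_finite_chi_square, symmetric])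
qed

text \<open>Two squares are split off the chi-square part and joined to the one with mean
  \<open>a\<close>, with the rest of the sum as outermost variable. For each fixed value of that
  rest the inner triple integral has the shape of the one in
  \<open>gauss_first_moment_eq_triple\<close>.\<close>

lemma nn_integral_chi_square_add_2:
  assumes [measurable]: "F \<in> borel_measurable borel"
  shows "(\<integral>\<^sup>+x. \<integral>\<^sup>+s. F (x\<^sup>2 + s) \<partial>chi_square (n + 2) \<partial>gauss a)
    = (\<integral>\<^sup>+s. \<integral>\<^sup>+x. \<integral>\<^sup>+y. \<integral>\<^sup>+z. F (x\<^sup>2 + (y\<^sup>2 + z\<^sup>2) + s) \<partial>gauss 0 \<partial>gauss 0 \<partial>gauss a \<partial>chi_square n)"
proof -
  note sf = sigma_finite_gauss sigma_finite_chi_square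
  have 1: "(\<integral>\<^sup>+s. F (x\<^sup>2 + s) \<partial>chi_square (n + 2))
    = (\<integral>\<^sup>+y. \<integral>\<^sup>+z. \<integral>\<^sup>+s. F (x\<^sup>2 + (y\<^sup>2 + z\<^sup>2) + s) \<partial>chi_square n \<partial>gauss 0 \<partial>gauss 0)" for x
    by (simp add: numeral_2_eq_2 nn_integral_chi_square_Suc add.assoc del: chi_square.simps)
  have 2: "(\<integral>\<^sup>+z. \<integral>\<^sup>+s. F (x\<^sup>2 + (y\<^sup>2 + z\<^sup>2) + s) \<partial>chi_square n \<partial>gauss 0)
    = (\<integral>\<^sup>+s. \<integral>\<^sup>+z. F (x\<^sup>2 + (y\<^sup>2 + z\<^sup>2) + s) \<partial>gauss 0 \<partial>chi_square n)" for x y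
    by (intro nn_integral_swap sf) measurable
  have 3: "(\<integral>\<^sup>+y. \<integral>\<^sup>+s. \<integral>\<^sup>+z. F (x\<^sup>2 + (y\<^sup>2 + z\<^sup>2) + s) \<partial>gauss 0 \<partial>chi_square n \<partial>gauss 0)
    = (\<integral>\<^sup>+s. \<integral>\<^sup>+y. \<integral>\<^sup>+z. F (x\<^sup>2 + (y\<^sup>2 + z\<^sup>2) + s) \<partial>gauss 0 \<partial>gauss 0 \<partial>chi_square n)" for x
    by (intro nn_integral_swap sf) measurable
  have 4: "(\<integral>\<^sup>+x. \<integral>\<^sup>+s. \<integral>\<^sup>+y. \<integral>\<^sup>+z. F (x\<^sup>2 + (y\<^sup>2 + z\<^sup>2) + s) \<partial>gauss 0 \<partial>gauss 0 \<partial>chi_square n \<partial>gauss a)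
    = (\<integral>\<^sup>+s. \<integral>\<^sup>+x. \<integral>\<^sup>+y. \<integral>\<^sup>+z. F (x\<^sup>2 + (y\<^sup>2 + z\<^sup>2) + s) \<partial>gauss 0 \<partial>gauss 0 \<partial>gauss a \<partial>chi_square n)"
    by (intro nn_integral_swap sf) measurable
  have "(\<integral>\<^sup>+x. \<integral>\<^sup>+s. F (x\<^sup>2 + s) \<partial>chi_square (n + 2) \<partial>gauss a)
    = (\<integral>\<^sup>+x. \<integral>\<^sup>+y. \<integral>\<^sup>+z. \<integral>\<^sup>+s. F (x\<^sup>2 + (y\<^sup>2 + z\<^sup>2) + s) \<partial>chi_square n \<partial>gauss 0 \<partial>gauss 0 \<partial>gauss a)"
    by (rule nn_integral_cong) (rule 1)
  also have "\<dots> = (\<integral>\<^sup>+x. \<integral>\<^sup>+s. \<integral>\<^sup>+y. \<integral>\<^sup>+z. F (x\<^sup>2 + (y\<^sup>2 + z\<^sup>2) + s) \<partial>gauss 0 \<partial>gauss 0 \<partial>chi_square n \<partial>gauss a)"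
    unfolding 2 by (rule nn_integral_cong) (rule 3)
  also have "\<dots> = (\<integral>\<^sup>+s. \<integral>\<^sup>+x. \<integral>\<^sup>+y. \<integral>\<^sup>+z. F (x\<^sup>2 + (y\<^sup>2 + z\<^sup>2) + s) \<partial>gauss 0 \<partial>gauss 0 \<partial>gauss a \<partial>chi_square n)"
    by (rule 4)
  finally show ?thesis .
qed

text \<open>For a fixed chi-square value \<open>s\<close>,
  \<open>gauss_first_moment_eq_triple\<close> is applied to F(. + s); integrating over
  \<open>s\<close> turns the two extra Gaussian squares into two extra degrees of freedom.\<close>

lemma gauss_chi_first_moment:
  assumes F[measurable]: "F \<in> borel_measurable borel" and d: "d > 0"
  shows "(\<integral>\<^sup>+(x, s). ennreal x * F (x\<^sup>2 + s) \<partial>gauss_chi d n)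
    = (\<integral>\<^sup>+(x, s). ennreal (- x) * F (x\<^sup>2 + s) \<partial>gauss_chi d n)
      + ennreal d * (\<integral>\<^sup>+(x, s). F (x\<^sup>2 + s) \<partial>gauss_chi d (n + 2))"
proof -
  note sf = sigma_finite_gauss sigma_finite_chi_square
  have 1: "(\<integral>\<^sup>+(x, s). ennreal (f x) * F (x\<^sup>2 + s) \<partial>gauss_chi d n) = (\<integral>\<^sup>+s. \<integral>\<^sup>+x. ennreal (f x) * F (x\<^sup>2 + s) \<partial>gauss d \<partial>chi_square n)"
    if [measurable]: "f \<in> borel_measurable borel" for f :: "real \<Rightarrow> real"
    by (subst nn_integral_gauss_chi, (simp add: borel_prod[symmetric]; fail), intro nn_integral_swap sf) measurable
  have 2: "(\<integral>\<^sup>+(x, s). F (x\<^sup>2 + s) \<partial>gauss_chi d (n + 2))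
    = (\<integral>\<^sup>+s. \<integral>\<^sup>+x. \<integral>\<^sup>+y. \<integral>\<^sup>+z. F (x\<^sup>2 + (y\<^sup>2 + z\<^sup>2) + s) \<partial>gauss 0 \<partial>gauss 0 \<partial>gauss d \<partial>chi_square n)"
    by (subst nn_integral_gauss_chi, (simp add: borel_prod[symmetric]; fail), rule nn_integral_chi_square_add_2) measurable
  have 3: "(\<integral>\<^sup>+x. ennreal x * F (x\<^sup>2 + s) \<partial>gauss d)
    = (\<integral>\<^sup>+x. ennreal (- x) * F (x\<^sup>2 + s) \<partial>gauss d)
      + ennreal d * (\<integral>\<^sup>+x. \<integral>\<^sup>+y. \<integral>\<^sup>+z. F (x\<^sup>2 + (y\<^sup>2 + z\<^sup>2) + s) \<partial>gauss 0 \<partial>gauss 0 \<partial>gauss d)" for s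
    using gauss_first_moment_eq_triple[of "\<lambda>t. F (t + s)", OF _ d] by simp
  show ?thesis
    unfolding 1[of "\<lambda>x. x", simplified] 1[of uminus, simplified] 2 3
    by (simp add: nn_integral_add nn_integral_cmult)
qed

text \<open>Integrability makes the contributions \<open>P\<close> and \<open>N\<close> of positive
  and negative \<open>x\<close> finite, which permits subtracting \<open>N\<close> in the identity
  between extended nonnegative reals.\<close>

lemma integral_gauss_chi_first_moment_nonneg:
  fixes h :: "real \<Rightarrow> real"
  assumes [measurable]: "h \<in> borel_measurable borel" and d: "d > 0" and h: "\<And>x. h x \<ge> 0"
    and i1: "integrable (gauss_chi d n) (\<lambda>(x, s). h (x\<^sup>2 + s) * x)"
    and i2: "integrable (gauss_chi d (n + 2)) (\<lambda>(x, s). h (x\<^sup>2 + s))"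
  shows "(\<integral>(x, s). h (x\<^sup>2 + s) * x \<partial>gauss_chi d n) = d * (\<integral>(x, s). h (x\<^sup>2 + s) \<partial>gauss_chi d (n + 2))"
proof -
  let ?f = "\<lambda>(x, s). h (x\<^sup>2 + s) * x" and ?k = "\<lambda>(x, s). h (x\<^sup>2 + s)"
  define P where "P = (\<integral>\<^sup>+p. ennreal (?f p) \<partial>gauss_chi d n)"
  define N where "N = (\<integral>\<^sup>+p. ennreal (- ?f p) \<partial>gauss_chi d n)"
  define Q where "Q = (\<integral>\<^sup>+p. ennreal (?k p) \<partial>gauss_chi d (n + 2))"
  have fin: "P \<noteq> \<infinity>" "N \<noteq> \<infinity>" using i1 unfolding real_integrable_def P_def N_def by auto
  have Q: "Q = ennreal (\<integral>p. ?k p \<partial>gauss_chi d (n + 2))" unfolding Q_def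
    using i2 by (intro nn_integral_eq_integral) (auto simp: h)
  have e: "ennreal (h u * x) = ennreal x * ennreal (h u)" for u x
    by (subst ennreal_mult'[OF h]) (rule mult.commute)
  have "P = (\<integral>\<^sup>+(x, s). ennreal x * ennreal (h (x\<^sup>2 + s)) \<partial>gauss_chi d n)"
    unfolding P_def by (intro nn_integral_cong) (auto simp: e)
  also have "\<dots> = (\<integral>\<^sup>+(x, s). ennreal (- x) * ennreal (h (x\<^sup>2 + s)) \<partial>gauss_chi d n)
      + ennreal d * (\<integral>\<^sup>+(x, s). ennreal (h (x\<^sup>2 + s)) \<partial>gauss_chi d (n + 2))"
    by (rule gauss_chi_first_moment[OF _ d]) measurable
  also have "(\<integral>\<^sup>+(x, s). ennreal (- x) * ennreal (h (x\<^sup>2 + s)) \<partial>gauss_chi d n) = N"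
    unfolding N_def by (intro nn_integral_cong) (auto simp: e[symmetric])
  also have "(\<integral>\<^sup>+(x, s). ennreal (h (x\<^sup>2 + s)) \<partial>gauss_chi d (n + 2)) = Q"
    unfolding Q_def by (intro nn_integral_cong) auto
  finally have PN: "P = N + ennreal d * Q" .
  have qn: "(\<integral>p. ?k p \<partial>gauss_chi d (n + 2)) \<ge> 0" by (intro Bochner_Integration.integral_nonneg) (auto simp: h)
  have "(\<integral>p. ?f p \<partial>gauss_chi d n) = enn2real P - enn2real N"
    unfolding P_def N_def by (rule real_lebesgue_integral_def[OF i1])
  also have "\<dots> = d * (\<integral>p. ?k p \<partial>gauss_chi d (n + 2))"
    using PN fin qn d unfolding Q
    by (cases N) (auto simp: ennreal_mult[symmetric] ennreal_plus[symmetric] simp del: ennreal_plus)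
  finally show ?thesis .
qed

lemma integral_gauss_chi_first_moment:
  fixes h :: "real \<Rightarrow> real"
  assumes [measurable]: "h \<in> borel_measurable borel" and d: "d > 0"
    and i1: "integrable (gauss_chi d n) (\<lambda>(x, s). h (x\<^sup>2 + s) * x)"
    and i2: "integrable (gauss_chi d (n + 2)) (\<lambda>(x, s). h (x\<^sup>2 + s))"
  shows "(\<integral>(x, s). h (x\<^sup>2 + s) * x \<partial>gauss_chi d n) = d * (\<integral>(x, s). h (x\<^sup>2 + s) \<partial>gauss_chi d (n + 2))"
proof -
  define hp where "hp x = max 0 (h x)" for x
  define hn where "hn x = max 0 (- h x)" for x
  have h: "h x = hp x - hn x" for x by (simp add: hp_def hn_def)
  have [measurable]: "hp \<in> borel_measurable borel" "hn \<in> borel_measurable borel"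
    unfolding hp_def hn_def by measurable
  have ip1: "integrable (gauss_chi d n) (\<lambda>(x, s). hp (x\<^sup>2 + s) * x)"
    and in1: "integrable (gauss_chi d n) (\<lambda>(x, s). hn (x\<^sup>2 + s) * x)"
    by (rule Bochner_Integration.integrable_bound[OF i1]; auto intro!: AE_I2 simp: hp_def hn_def abs_mult intro!: mult_right_mono)+
  have ip2: "integrable (gauss_chi d (n + 2)) (\<lambda>(x, s). hp (x\<^sup>2 + s))"
    and in2: "integrable (gauss_chi d (n + 2)) (\<lambda>(x, s). hn (x\<^sup>2 + s))"
    by (rule Bochner_Integration.integrable_bound[OF i2]; auto intro!: AE_I2 simp: hp_def hn_def)+
  have p: "(\<integral>(x, s). hp (x\<^sup>2 + s) * x \<partial>gauss_chi d n) = d * (\<integral>(x, s). hp (x\<^sup>2 + s) \<partial>gauss_chi d (n + 2))"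
    by (rule integral_gauss_chi_first_moment_nonneg[OF _ d _ ip1 ip2]) (auto simp: hp_def)
  have n: "(\<integral>(x, s). hn (x\<^sup>2 + s) * x \<partial>gauss_chi d n) = d * (\<integral>(x, s). hn (x\<^sup>2 + s) \<partial>gauss_chi d (n + 2))"
    by (rule integral_gauss_chi_first_moment_nonneg[OF _ d _ in1 in2]) (auto simp: hn_def)
  have "(\<integral>(x, s). h (x\<^sup>2 + s) * x \<partial>gauss_chi d n)
     = (\<integral>(x, s). hp (x\<^sup>2 + s) * x \<partial>gauss_chi d n) - (\<integral>(x, s). hn (x\<^sup>2 + s) * x \<partial>gauss_chi d n)"
    by (subst Bochner_Integration.integral_diff[OF ip1 in1, symmetric])
      (auto intro!: Bochner_Integration.integral_cong simp: h left_diff_distrib)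
  moreover have "(\<integral>(x, s). h (x\<^sup>2 + s) \<partial>gauss_chi d (n + 2))
     = (\<integral>(x, s). hp (x\<^sup>2 + s) \<partial>gauss_chi d (n + 2)) - (\<integral>(x, s). hn (x\<^sup>2 + s) \<partial>gauss_chi d (n + 2))"
    by (subst Bochner_Integration.integral_diff[OF ip2 in2, symmetric])
      (auto intro!: Bochner_Integration.integral_cong simp: h)
  ultimately show ?thesis by (simp add: p n right_diff_distrib)
qed

section \<open>Normal form of the noncentral chi-square law\<close>

lemma nn_integral_gauss_even:
  assumes [measurable]: "F \<in> borel_measurable borel"
  shows "(\<integral>\<^sup>+x. F (x\<^sup>2) \<partial>gauss \<bar>a\<bar>) = (\<integral>\<^sup>+x. F (x\<^sup>2) \<partial>gauss a)"
proof (cases "a \<ge> 0")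
  case False
  have "(\<integral>\<^sup>+x. F (x\<^sup>2) \<partial>gauss \<bar>a\<bar>) = (\<integral>\<^sup>+x. ennreal (normal_density (- a) 1 x) * F (x\<^sup>2) \<partial>lborel)"
    using False by (simp add: nn_integral_gauss)
  also have "\<dots> = (\<integral>\<^sup>+x. ennreal (normal_density (- a) 1 (- x)) * F ((- x)\<^sup>2) \<partial>lborel)"
    by (rule nn_integral_lborel_reflect[symmetric]) measurable
  also have "\<dots> = (\<integral>\<^sup>+x. F (x\<^sup>2) \<partial>gauss a)"
    by (simp add: nn_integral_gauss normal_density_def power2_commute)
  finally show ?thesis .
qed simp

lemma product_sigma_finite_gauss: "product_sigma_finite (\<lambda>i. gauss (\<theta> i))"
  by (intro product_sigma_finite.intro sigma_finite_gauss)

lemma sigma_finite_PiM_gauss: "sigma_finite_measure (\<Pi>\<^sub>M i\<in>I. gauss (\<theta> i))"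
  by (intro prob_space_imp_sigma_finite prob_space_PiM prob_space_gauss)

text \<open>A further coordinate, with mean \<open>a\<close>, accumulates the noncentrality. Each
  coordinate \<open>j\<close> is rotated together with it: the mean of \<open>j\<close> moves into
  the accumulator, and the central square that is left joins \<open>chi_square\<close>.\<close>

lemma nn_integral_PiM_gauss_noncentral:
  assumes "finite I" "F \<in> borel_measurable borel"
  shows "(\<integral>\<^sup>+x. \<integral>\<^sup>+y. F (x\<^sup>2 + (\<Sum>i\<in>I. (y i)\<^sup>2)) \<partial>(\<Pi>\<^sub>M i\<in>I. gauss (\<theta> i)) \<partial>gauss a)
    = (\<integral>\<^sup>+x. \<integral>\<^sup>+s. F (x\<^sup>2 + s) \<partial>chi_square (card I) \<partial>gauss (sqrt (a\<^sup>2 + (\<Sum>i\<in>I. (\<theta> i)\<^sup>2))))"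
  using assms
proof (induction I arbitrary: a F rule: finite_induct)
  case empty
  note [measurable] = empty.prems
  \<comment> \<open>Without coordinates the accumulated mean is sqrt(a^2) = |a|, and the sign of a
    mean does not affect the law of the square.\<close>
  show ?case
    by (simp add: PiM_empty nn_integral_count_space_finite nn_integral_return nn_integral_gauss_even)
next
  case (insert j I)
  note [measurable] = insert.prems
  note fin[simp] = insert.hyps
  let ?P = "\<Pi>\<^sub>M i\<in>I. gauss (\<theta> i)"
  interpret P: sigma_finite_measure ?P by (rule sigma_finite_PiM_gauss)
  note sf = sigma_finite_gauss sigma_finite_chi_square sigma_finite_PiM_gauss
  define r where "r = sqrt (a\<^sup>2 + (\<Sum>i\<in>I. (\<theta> i)\<^sup>2))"
  have r: "r\<^sup>2 = a\<^sup>2 + (\<Sum>i\<in>I. (\<theta> i)\<^sup>2)" by (simp add: r_def sum_nonneg)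
  have "(\<integral>\<^sup>+x. \<integral>\<^sup>+y. F (x\<^sup>2 + (\<Sum>i\<in>insert j I. (y i)\<^sup>2)) \<partial>(\<Pi>\<^sub>M i\<in>insert j I. gauss (\<theta> i)) \<partial>gauss a)
     = (\<integral>\<^sup>+x. \<integral>\<^sup>+v. \<integral>\<^sup>+y. F (v\<^sup>2 + (x\<^sup>2 + (\<Sum>i\<in>I. (y i)\<^sup>2))) \<partial>?P \<partial>gauss (\<theta> j) \<partial>gauss a)"
  proof (rule nn_integral_cong)
    fix x
    have s: "(\<Sum>i\<in>I. ((y(j := v)) i)\<^sup>2) = (\<Sum>i\<in>I. (y i)\<^sup>2)" for y :: "'a \<Rightarrow> real" and v
      using fin by (intro sum.cong) auto
    show "(\<integral>\<^sup>+y. F (x\<^sup>2 + (\<Sum>i\<in>insert j I. (y i)\<^sup>2)) \<partial>(\<Pi>\<^sub>M i\<in>insert j I. gauss (\<theta> i)))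
      = (\<integral>\<^sup>+v. \<integral>\<^sup>+y. F (v\<^sup>2 + (x\<^sup>2 + (\<Sum>i\<in>I. (y i)\<^sup>2))) \<partial>?P \<partial>gauss (\<theta> j))"
      by (subst product_sigma_finite.product_nn_integral_insert_rev[OF product_sigma_finite_gauss fin])
        (measurable, simp only: sum.insert[OF fin] s fun_upd_same add.left_commute)
  qed
  also have "\<dots> = (\<integral>\<^sup>+v. \<integral>\<^sup>+x. \<integral>\<^sup>+y. F (v\<^sup>2 + (x\<^sup>2 + (\<Sum>i\<in>I. (y i)\<^sup>2))) \<partial>?P \<partial>gauss a \<partial>gauss (\<theta> j))"
    by (intro nn_integral_swap sf) measurable
  also have "\<dots> = (\<integral>\<^sup>+v. \<integral>\<^sup>+x. \<integral>\<^sup>+s. F (v\<^sup>2 + (x\<^sup>2 + s)) \<partial>chi_square (card I) \<partial>gauss r \<partial>gauss (\<theta> j))"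
    unfolding r_def by (rule nn_integral_cong) (rule insert.IH[of "\<lambda>t. F (v\<^sup>2 + t)" for v], measurable)
  also have "\<dots> = (\<integral>\<^sup>+x. \<integral>\<^sup>+v. \<integral>\<^sup>+s. F (v\<^sup>2 + (x\<^sup>2 + s)) \<partial>chi_square (card I) \<partial>gauss (\<theta> j) \<partial>gauss r)"
    by (intro nn_integral_swap sf) measurable
  also have "\<dots> = (\<integral>\<^sup>+x. \<integral>\<^sup>+v. \<integral>\<^sup>+s. F (x\<^sup>2 + v\<^sup>2 + s) \<partial>chi_square (card I) \<partial>gauss (\<theta> j) \<partial>gauss r)"
    by (simp only: add.assoc add.left_commute)
  also have "\<dots> = (\<integral>\<^sup>+x. \<integral>\<^sup>+v. \<integral>\<^sup>+s. F (x\<^sup>2 + v\<^sup>2 + s) \<partial>chi_square (card I) \<partial>gauss 0 \<partial>gauss (sqrt (r\<^sup>2 + (\<theta> j)\<^sup>2)))"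
    by (rule gauss_pair_rotation[of "\<lambda>t. \<integral>\<^sup>+s. F (t + s) \<partial>chi_square (card I)"]) measurable
  also have "\<dots> = (\<integral>\<^sup>+x. \<integral>\<^sup>+s. F (x\<^sup>2 + s) \<partial>chi_square (card (insert j I)) \<partial>gauss (sqrt (r\<^sup>2 + (\<theta> j)\<^sup>2)))"
    by (simp add: nn_integral_chi_square_Suc add.assoc del: chi_square.simps)
  finally show ?case by (simp add: r add.assoc add.commute[of "(\<theta> j)\<^sup>2"])
qed

text \<open>The counterpart without a coordinate that carries a mean, for the directions in the
  range of the projection that are orthogonal to \<open>w\<close>.\<close>

lemma nn_integral_PiM_gauss_central:
  assumes "finite I" "F \<in> borel_measurable borel"
  shows "(\<integral>\<^sup>+y. F (\<Sum>i\<in>I. (y i)\<^sup>2) \<partial>(\<Pi>\<^sub>M i\<in>I. gauss 0)) = (\<integral>\<^sup>+s. F s \<partial>chi_square (card I))"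
  using assms
proof (induction I arbitrary: F rule: finite_induct)
  case empty
  then show ?case
    by (simp add: PiM_empty nn_integral_count_space_finite nn_integral_return)
next
  case (insert j I)
  note [measurable] = insert.prems
  note fin[simp] = insert.hyps
  have s: "(\<Sum>i\<in>I. ((y(j := v)) i)\<^sup>2) = (\<Sum>i\<in>I. (y i)\<^sup>2)" for y :: "'a \<Rightarrow> real" and v
    using fin by (intro sum.cong) auto
  have "(\<integral>\<^sup>+y. F (\<Sum>i\<in>insert j I. (y i)\<^sup>2) \<partial>(\<Pi>\<^sub>M i\<in>insert j I. gauss 0))
    = (\<integral>\<^sup>+v. \<integral>\<^sup>+y. F (v\<^sup>2 + (\<Sum>i\<in>I. (y i)\<^sup>2)) \<partial>(\<Pi>\<^sub>M i\<in>I. gauss 0) \<partial>gauss 0)"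
    by (subst product_sigma_finite.product_nn_integral_insert_rev[OF product_sigma_finite_gauss[of "\<lambda>_. 0"] fin])
      (measurable, simp only: sum.insert[OF fin] s fun_upd_same)
  also have "\<dots> = (\<integral>\<^sup>+v. \<integral>\<^sup>+s. F (v\<^sup>2 + s) \<partial>chi_square (card I) \<partial>gauss 0)"
    by (rule nn_integral_cong) (rule insert.IH[of "\<lambda>t. F (v\<^sup>2 + t)" for v], measurable)
  finally show ?case by (simp add: nn_integral_chi_square_Suc del: chi_square.simps)
qed

text \<open>The coordinate with index \<open>n\<close>, present because the degrees of freedom are
  positive, serves as accumulator and ends up with mean \<open>sqrt \<Delta>\<close>. The result no
  longer mentions \<open>\<theta>\<close>, so the choice of the mean vector in
  \<open>noncentral_chi_square\<close> is immaterial here.\<close>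

lemma noncentral_chi_square_Suc:
  assumes "noncentral_chi_square (Suc n) \<Delta> Q"
  shows "Q = distr (gauss_chi (sqrt \<Delta>) n) borel (\<lambda>(x, s). x\<^sup>2 + s)"
proof -
  obtain \<theta> :: "nat \<Rightarrow> real" where \<theta>: "(\<Sum>i<Suc n. (\<theta> i)\<^sup>2) = \<Delta>"
    and Q: "Q = distr (\<Pi>\<^sub>M i\<in>{..<Suc n}. gauss (\<theta> i)) borel (\<lambda>x. \<Sum>i<Suc n. (x i)\<^sup>2)"
    using assms unfolding noncentral_chi_square_def gauss_def by blast
  show ?thesis
  proof (rule measure_eqI)
    fix S assume "S \<in> sets Q"
    then have [measurable]: "S \<in> sets borel" by (simp add: Q)
    define F :: "real \<Rightarrow> ennreal" where "F = indicator S"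
    have [measurable]: "F \<in> borel_measurable borel" by (simp add: F_def)
    have m: "(\<lambda>(x, s). F (x\<^sup>2 + s)) \<in> borel_measurable borel" by (simp add: borel_prod[symmetric])
    have fin: "finite {..<n}" "n \<notin> {..<n}" by auto
    interpret P: sigma_finite_measure "\<Pi>\<^sub>M i\<in>{..<n}. gauss (\<theta> i)" by (rule sigma_finite_PiM_gauss)
    have s: "(\<Sum>i<n. ((y(n := v)) i)\<^sup>2) = (\<Sum>i<n. (y i)\<^sup>2)" for y :: "nat \<Rightarrow> real" and v
      by (intro sum.cong) auto
    have "emeasure Q S = (\<integral>\<^sup>+x. F x \<partial>Q)" by (simp add: F_def Q)
    also have "\<dots> = (\<integral>\<^sup>+y. F (\<Sum>i\<in>insert n {..<n}. (y i)\<^sup>2) \<partial>(\<Pi>\<^sub>M i\<in>insert n {..<n}. gauss (\<theta> i)))"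
      unfolding Q lessThan_Suc by (rule nn_integral_distr) measurable
    also have "\<dots> = (\<integral>\<^sup>+v. \<integral>\<^sup>+y. F (v\<^sup>2 + (\<Sum>i<n. (y i)\<^sup>2)) \<partial>(\<Pi>\<^sub>M i\<in>{..<n}. gauss (\<theta> i)) \<partial>gauss (\<theta> n))"
    proof -
      have m: "(\<lambda>y. F (\<Sum>i\<in>insert n {..<n}. (y i)\<^sup>2)) \<in> borel_measurable (\<Pi>\<^sub>M i\<in>insert n {..<n}. gauss (\<theta> i))"
        by measurable
      show ?thesis
        unfolding product_sigma_finite.product_nn_integral_insert_rev[OF product_sigma_finite_gauss fin m]
        by (simp only: sum.insert[OF fin] s fun_upd_same)
    qed
    also have "\<dots> = (\<integral>\<^sup>+x. \<integral>\<^sup>+s. F (x\<^sup>2 + s) \<partial>chi_square n \<partial>gauss (sqrt \<Delta>))"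
      by (subst nn_integral_PiM_gauss_noncentral) (use \<theta> in \<open>simp_all add: add.commute\<close>)
    also have "\<dots> = (\<integral>\<^sup>+p. F (case p of (x, s) \<Rightarrow> x\<^sup>2 + s) \<partial>gauss_chi (sqrt \<Delta>) n)"
      using nn_integral_gauss_chi[OF m] by (simp add: case_prod_beta)
    also have "\<dots> = (\<integral>\<^sup>+x. F x \<partial>distr (gauss_chi (sqrt \<Delta>) n) borel (\<lambda>(x, s). x\<^sup>2 + s))"
      by (rule nn_integral_distr[symmetric]) measurable
    also have "\<dots> = emeasure (distr (gauss_chi (sqrt \<Delta>) n) borel (\<lambda>(x, s). x\<^sup>2 + s)) S"
      by (simp add: F_def)
    finally show "emeasure Q S = emeasure (distr (gauss_chi (sqrt \<Delta>) n) borel (\<lambda>(x, s). x\<^sup>2 + s)) S" .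
  qed (simp add: Q)
qed

section \<open>The standard normal law on vectors\<close>

text \<open>A finite product measure is determined by its values on rectangles, and there the
  integrand factorises.\<close>

lemma PiM_gauss_density:
  fixes I :: "'i set"
  assumes "finite I"
  shows "(\<Pi>\<^sub>M i\<in>I. gauss 0) = density (\<Pi>\<^sub>M i\<in>I. lborel) (\<lambda>x. \<Prod>i\<in>I. ennreal (std_normal_density (x i)))"
proof (rule product_sigma_finite.PiM_eqI[OF product_sigma_finite_gauss, symmetric])
  interpret L: product_sigma_finite "\<lambda>_::'i. lborel :: real measure" ..
  fix S :: "'i \<Rightarrow> real set" assume S: "\<And>i. i \<in> I \<Longrightarrow> S i \<in> sets (gauss 0)"
  then have [measurable]: "i \<in> I \<Longrightarrow> S i \<in> sets borel" for i by simp
  note [simp] = assms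
  have PS[measurable]: "Pi\<^sub>E I S \<in> sets (\<Pi>\<^sub>M i\<in>I. lborel :: real measure)"
    by (rule sets_PiM_I_finite) auto
  have "emeasure (density (\<Pi>\<^sub>M i\<in>I. lborel) (\<lambda>x. \<Prod>i\<in>I. ennreal (std_normal_density (x i)))) (Pi\<^sub>E I S)
    = (\<integral>\<^sup>+x. (\<Prod>i\<in>I. ennreal (std_normal_density (x i))) * indicator (Pi\<^sub>E I S) x \<partial>(\<Pi>\<^sub>M i\<in>I. lborel))"
    by (rule emeasure_density) measurable
  also have "\<dots> = (\<integral>\<^sup>+x. (\<Prod>i\<in>I. ennreal (std_normal_density (x i)) * indicator (S i) (x i)) \<partial>(\<Pi>\<^sub>M i\<in>I. lborel))"
  proof (rule nn_integral_cong)
    fix x :: "'i \<Rightarrow> real" assume "x \<in> space (\<Pi>\<^sub>M i\<in>I. lborel)"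
    then have ext: "x \<in> extensional I" by (auto simp: space_PiM PiE_def)
    show "(\<Prod>i\<in>I. ennreal (std_normal_density (x i))) * indicator (Pi\<^sub>E I S) x
      = (\<Prod>i\<in>I. ennreal (std_normal_density (x i)) * indicator (S i) (x i))"
    proof (cases "x \<in> Pi\<^sub>E I S")
      case True
      then show ?thesis by (auto intro!: prod.cong simp: PiE_iff)
    next
      case False
      then obtain i where "i \<in> I" "x i \<notin> S i" using ext by (auto simp: PiE_iff)
      then have "(\<Prod>i\<in>I. ennreal (std_normal_density (x i)) * indicator (S i) (x i)) = 0"
        by (intro prod_zero) (auto intro!: bexI[of _ i])
      then show ?thesis using False by simp
    qed
  qed
  also have "\<dots> = (\<Prod>i\<in>I. \<integral>\<^sup>+t. ennreal (std_normal_density t) * indicator (S i) t \<partial>lborel)"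
    by (rule L.product_nn_integral_prod) auto
  also have "\<dots> = (\<Prod>i\<in>I. emeasure (gauss 0) (S i))"
    by (intro prod.cong refl) (simp add: gauss_def emeasure_density)
  finally show "emeasure (density (\<Pi>\<^sub>M i\<in>I. lborel) (\<lambda>x. \<Prod>i\<in>I. ennreal (std_normal_density (x i)))) (Pi\<^sub>E I S)
    = (\<Prod>i\<in>I. emeasure (gauss 0) (S i))" .
qed (use assms in \<open>auto intro!: sets_PiM_cong\<close>)

lemma measurable_vec_lambda:
  "(\<lambda>f. \<chi> i. f i) \<in> (\<Pi>\<^sub>M i\<in>(UNIV :: 'n set). lborel :: real measure) \<rightarrow>\<^sub>M (borel :: (real ^ 'n) measure)"
  by (subst borel_measurable_euclidean_space) (auto simp: Basis_vec_def inner_axis)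

lemma lborel_vec:
  "(lborel :: (real ^ 'n) measure) = distr (\<Pi>\<^sub>M i\<in>(UNIV :: 'n set). lborel) borel (\<lambda>f. \<chi> i. f i)"
proof (rule lborel_eqI)
  interpret L: product_sigma_finite "\<lambda>_::'n. lborel :: real measure" ..
  fix l u :: "real ^ 'n" assume le: "\<And>b. b \<in> Basis \<Longrightarrow> l \<bullet> b \<le> u \<bullet> b"
  have le': "l $ i \<le> u $ i" for i using le[of "axis i 1"] by (simp add: inner_axis axis_in_Basis_iff)
  have "(\<lambda>f. \<chi> i. f i) -` box l u \<inter> space (\<Pi>\<^sub>M i\<in>(UNIV :: 'n set). lborel :: real measure)
      = Pi\<^sub>E UNIV (\<lambda>i. {l $ i<..<u $ i})"
    by (auto simp: mem_box_cart space_PiM PiE_iff)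
  then have "emeasure (distr (\<Pi>\<^sub>M i\<in>(UNIV :: 'n set). lborel) borel (\<lambda>f. \<chi> i. f i)) (box l u)
      = (\<Prod>i\<in>UNIV. ennreal (u $ i - l $ i))"
    using le' by (simp add: emeasure_distr[OF measurable_vec_lambda] L.emeasure_PiM)
  also have "\<dots> = ennreal (\<Prod>i\<in>UNIV. u $ i - l $ i)"
    using le' by (simp add: prod_ennreal)
  also have "(\<Prod>i\<in>UNIV. u $ i - l $ i) = (\<Prod>b\<in>range (\<lambda>i. axis i 1). (u - l) \<bullet> b)"
    by (subst prod.reindex) (auto simp: inj_on_def axis_eq_axis inner_axis)
  also have "range (\<lambda>i. axis i 1) = (Basis :: (real ^ 'n) set)"
    by (auto simp: Basis_vec_def)
  finally show "emeasure (distr (\<Pi>\<^sub>M i\<in>(UNIV :: 'n set). lborel) borel (\<lambda>f. \<chi> i. f i)) (box l u)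
      = (\<Prod>b\<in>Basis. (u - l) \<bullet> b)" .
qed simp

text \<open>\<open>std_mvn\<close> is given by a density on \<open>real ^ 'n\<close>, while
  integrating out or discarding coordinates takes place in product measures on functions; this
  translates between the two.\<close>

lemma std_mvn_eq_PiM:
  "(std_mvn :: (real ^ 'n) measure) = distr (\<Pi>\<^sub>M i\<in>(UNIV :: 'n set). gauss 0) borel (\<lambda>f. \<chi> i. f i)"
proof -
  note measurable_vec_lambda[measurable]
  have [measurable]: "(\<lambda>z::real^'n. z $ i) \<in> borel_measurable borel" for i
    by (intro borel_measurable_continuous_onI continuous_intros)
  have "(std_mvn :: (real ^ 'n) measure) = density (distr (\<Pi>\<^sub>M i\<in>(UNIV :: 'n set). lborel) borel (\<lambda>f. \<chi> i. f i))
      (\<lambda>z. ennreal (\<Prod>i\<in>UNIV. std_normal_density (z $ i)))"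
    unfolding std_mvn_def by (subst lborel_vec) simp
  also have "\<dots> = distr (density (\<Pi>\<^sub>M i\<in>(UNIV :: 'n set). lborel) (\<lambda>x. ennreal (\<Prod>i\<in>UNIV. std_normal_density (x i)))) borel (\<lambda>f. \<chi> i. f i)"
    by (subst density_distr) auto
  finally show ?thesis
    by (simp add: PiM_gauss_density prod_ennreal)
qed

lemma sets_std_mvn[simp, measurable_cong]: "sets std_mvn = sets borel"
  by (simp add: std_mvn_def)

lemma space_std_mvn[simp]: "space std_mvn = UNIV"
  by (simp add: std_mvn_def)

lemma distr_std_mvn_orthogonal:
  fixes T :: "real ^ 'n \<Rightarrow> real ^ 'n"
  assumes T: "orthogonal_transformation T"
  shows "distr std_mvn borel T = std_mvn"
proof (rule measure_eqI)
  have [measurable]: "T \<in> borel_measurable borel"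
    using orthogonal_transformation_linear[OF T]
    by (intro borel_measurable_continuous_onI linear_continuous_on) (metis linear_conv_bounded_linear)
  define \<phi> :: "real ^ 'n \<Rightarrow> ennreal" where "\<phi> z = ennreal (\<Prod>i\<in>UNIV. std_normal_density (z $ i))" for z
  have [measurable]: "(\<lambda>z::real^'n. z $ i) \<in> borel_measurable borel" for i
    by (intro borel_measurable_continuous_onI continuous_intros)
  have [measurable]: "\<phi> \<in> borel_measurable borel" unfolding \<phi>_def by measurable
  have "(\<Prod>i\<in>UNIV. std_normal_density (z $ i)) = (1 / sqrt (2 * pi)) ^ CARD('n) * exp (- (norm z)\<^sup>2 / 2)" for z :: "real ^ 'n"
  proof -
    have "(norm z)\<^sup>2 = (\<Sum>i\<in>UNIV. (z $ i)\<^sup>2)"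
      unfolding power2_norm_eq_inner inner_vec_def by (simp add: power2_eq_square)
    then show ?thesis
      by (simp add: normal_density_def prod.distrib exp_sum[symmetric] sum_divide_distrib sum_negf power_one_over prod_dividef)
  qed
  then have \<phi>T: "\<phi> (T z) = \<phi> z" for z
    by (simp add: \<phi>_def orthogonal_transformation_norm[OF T])
  fix S assume "S \<in> sets (distr std_mvn borel T)"
  then have [measurable]: "S \<in> sets borel" by simp
  have "emeasure (distr std_mvn borel T) S = (\<integral>\<^sup>+z. indicator S (T z) \<partial>std_mvn)"
    by (subst nn_integral_indicator[symmetric], simp, rule nn_integral_distr) measurable
  also have "\<dots> = (\<integral>\<^sup>+z. \<phi> (T z) * indicator S (T z) \<partial>lborel)"
    unfolding std_mvn_def \<phi>_def[symmetric] by (subst nn_integral_density) (auto simp: \<phi>T)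
  also have "\<dots> = (\<integral>\<^sup>+z. \<phi> z * indicator S z \<partial>lborel)"
    by (rule nn_integral_lborel_orthogonal[OF T, of "\<lambda>z. \<phi> z * indicator S z"]) measurable
  also have "\<dots> = emeasure std_mvn S"
    unfolding std_mvn_def \<phi>_def[symmetric] by (simp add: emeasure_density)
  finally show "emeasure (distr std_mvn borel T) S = emeasure std_mvn S" .
qed simp

lemma borel_measurable_matrix_vector_mult [measurable (raw)]:
  fixes A :: "real ^ 'n ^ 'm"
  assumes [measurable]: "f \<in> borel_measurable M"
  shows "(\<lambda>x. A *v f x) \<in> borel_measurable M"
proof -
  have "(*v) A \<in> borel_measurable borel"
    by (intro borel_measurable_continuous_onI linear_continuous_on)
      (metis linear_conv_bounded_linear matrix_vector_mul_linear)
  then show ?thesis by measurable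
qed

text \<open>\<open>T\<close> sends coordinates to an orthonormal basis \<open>b\<close> adapted to
  the range of \<open>P\<close> and to \<open>w\<close>, and leaves the standard normal law
  unchanged. In these coordinates the first component is |w| plus coordinate \<open>i0\<close>, and
  the second is the sum of squares over \<open>J\<close>, the other n directions in the range of
  \<open>P\<close>. As functions of disjoint sets of coordinates they are independent.\<close>

lemma std_mvn_projection_law:
  fixes P :: "real ^ 'n ^ 'n"
  assumes sym: "transpose P = P" and idem: "P ** P = P" and w: "P *v w = w" "w \<noteq> 0" and rank: "rank P = Suc n"
  defines "U \<equiv> \<lambda>z. norm w + (w \<bullet> z) / norm w"
  shows "distr std_mvn borel (\<lambda>z. (U z, (norm (P *v (w + z)))\<^sup>2 - (U z)\<^sup>2)) = gauss_chi (norm w) n"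
    (is "distr _ _ ?f = _")
proof (rule measure_eqI)
  have Psym: "(P *v x) \<bullet> y = x \<bullet> (P *v y)" for x y using sym by (rule matrix_inner_commute)
  have PP: "P *v (P *v x) = P *v x" for x by (simp add: matrix_vector_mul_assoc idem)
  define R where "R = range ((*v) P)"
  have R: "x \<in> R \<longleftrightarrow> P *v x = x" for x unfolding R_def using PP by (metis rangeE rangeI)
  have subR: "subspace R" unfolding R_def by (intro linear_subspace_image subspace_UNIV) simp
  have dimR: "dim R = Suc n" using rank by (simp add: R_def rank_dim_range)
  obtain b :: "'n \<Rightarrow> real ^ 'n" and i0 where b: "\<And>i j. b i \<bullet> b j = (if i = j then 1 else 0)"
    "b i0 = (1 / norm w) *\<^sub>R w" "card {i. b i \<in> R} = dim R"
    "\<And>i x. b i \<notin> R \<Longrightarrow> x \<in> R \<Longrightarrow> b i \<bullet> x = 0"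
    using adapted_orthonormal_basis[OF subR, of w] w R by metis
  define K where "K = {i. b i \<in> R}"
  have i0: "i0 \<in> K" using w R subR by (auto simp: K_def b(2) intro!: subspace_scale)
  define J where "J = K - {i0}"
  have cardJ: "card J = n" using b(3) dimR i0 by (simp add: J_def K_def)
  define T :: "real ^ 'n \<Rightarrow> real ^ 'n" where "T z = (\<Sum>i\<in>UNIV. (z $ i) *\<^sub>R b i)" for z
  have linT: "linear T" by (rule linearI) (auto simp: T_def algebra_simps sum.distrib scaleR_sum_right)
  have bT: "b i \<bullet> T z = z $ i" for i z
    by (simp add: T_def inner_sum_right b(1) if_distrib cong: if_cong)
  have "T v \<bullet> T z = v \<bullet> z" for v z
  proof -
    have "T v \<bullet> T z = (\<Sum>i\<in>UNIV. v $ i * (b i \<bullet> T z))" by (subst T_def) (simp add: inner_sum_left)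
    then show ?thesis unfolding bT by (simp add: inner_vec_def)
  qed
  then have T: "orthogonal_transformation T" using linT by (simp add: orthogonal_transformation_def)
  have parseval: "(norm x)\<^sup>2 = (\<Sum>i\<in>UNIV. (b i \<bullet> x)\<^sup>2)" for x
  proof -
    obtain y where "x = T y" using orthogonal_transformation_surj[OF T] by (metis surjD)
    then have "(norm x)\<^sup>2 = (norm y)\<^sup>2" "b i \<bullet> x = y $ i" for i
      by (simp_all add: bT orthogonal_transformation_norm[OF T])
    then show ?thesis unfolding power2_norm_eq_inner inner_vec_def by (simp add: power2_eq_square)
  qed
  \<comment> \<open>\<open>P\<close> fixes the basis vectors in its range and kills the others, so
    |P x|^2 is a partial Parseval sum.\<close>
  have normP: "(norm (P *v x))\<^sup>2 = (\<Sum>i\<in>K. (b i \<bullet> x)\<^sup>2)" for x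
  proof -
    have "b i \<bullet> (P *v x) = (if i \<in> K then b i \<bullet> x else 0)" for i
      using b(4)[of i "P *v x"] R[of "b i"] R[of "P *v x"] PP Psym[of "b i" x] by (auto simp: K_def)
    then have "(norm (P *v x))\<^sup>2 = (\<Sum>i\<in>UNIV. if i \<in> K then (b i \<bullet> x)\<^sup>2 else 0)"
      unfolding parseval by (intro sum.cong) auto
    then show ?thesis by (simp add: sum.If_cases)
  qed
  have wb: "w = norm w *\<^sub>R b i0" using w by (simp add: b(2))
  have bw: "b i \<bullet> w = (if i = i0 then norm w else 0)" for i
    by (subst wb) (simp add: b(1))
  have UT: "U (T z) = norm w + z $ i0" for z
  proof -
    have "w \<bullet> T z = norm w * z $ i0" by (subst wb) (simp add: bT)
    then show ?thesis using w by (simp add: U_def)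
  qed
  have VT: "(norm (P *v (w + T z)))\<^sup>2 - (U (T z))\<^sup>2 = (\<Sum>i\<in>J. (z $ i)\<^sup>2)" for z
  proof -
    have "(norm (P *v (w + T z)))\<^sup>2 = (\<Sum>i\<in>insert i0 J. (b i \<bullet> (w + T z))\<^sup>2)"
      using i0 by (simp add: normP J_def insert_absorb)
    also have "\<dots> = (norm w + z $ i0)\<^sup>2 + (\<Sum>i\<in>J. (b i \<bullet> (w + T z))\<^sup>2)"
      by (subst sum.insert) (auto simp: J_def inner_add_right bw bT)
    also have "(\<Sum>i\<in>J. (b i \<bullet> (w + T z))\<^sup>2) = (\<Sum>i\<in>J. (z $ i)\<^sup>2)"
      by (intro sum.cong) (auto simp: J_def inner_add_right bw bT)
    finally show ?thesis by (simp add: UT)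
  qed
  have [measurable]: "U \<in> borel_measurable borel" unfolding U_def by measurable
  have [measurable]: "T \<in> borel_measurable borel"
    using linT by (intro borel_measurable_continuous_onI linear_continuous_on) (metis linear_conv_bounded_linear)
  have [measurable]: "?f \<in> borel_measurable borel" unfolding borel_prod[symmetric] by measurable
  show "sets (distr std_mvn borel ?f) = sets (gauss_chi (norm w) n)"
    by (simp add: borel_prod[symmetric] cong: sets_pair_measure_cong)
  fix S assume "S \<in> sets (distr std_mvn borel ?f)"
  then have S[measurable]: "S \<in> sets borel" by simp
  define F :: "real \<Rightarrow> real \<Rightarrow> ennreal" where "F u v = indicator S (u, v)" for u v
  have F_ind: "case_prod F = indicator S" by (auto simp: F_def fun_eq_iff)
  have F: "case_prod F \<in> borel_measurable borel" by (simp add: F_ind)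
  then have [measurable]: "case_prod F \<in> borel_measurable (borel \<Otimes>\<^sub>M borel)" by (simp add: borel_prod)
  let ?N = "\<lambda>I :: 'n set. \<Pi>\<^sub>M i\<in>I. gauss 0"
  let ?I = "UNIV - {i0}"
  have JI: "J \<subseteq> ?I" by (auto simp: J_def)
  have finI: "finite ?I" "i0 \<notin> ?I" and insI: "insert i0 ?I = UNIV" by auto
  interpret N: sigma_finite_measure "?N I" for I by (rule sigma_finite_PiM_gauss)
  interpret pp: product_prob_space "\<lambda>_::'n. gauss 0" ?I ..
  have "emeasure (distr std_mvn borel ?f) S = (\<integral>\<^sup>+z. case_prod F (?f z) \<partial>std_mvn)"
    by (subst nn_integral_indicator[symmetric], simp, subst nn_integral_distr) (simp_all add: F_ind)
  also have "\<dots> = (\<integral>\<^sup>+z. case_prod F (?f z) \<partial>distr std_mvn borel T)"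
    by (simp add: distr_std_mvn_orthogonal[OF T])
  also have "\<dots> = (\<integral>\<^sup>+z. case_prod F (?f (T z)) \<partial>std_mvn)"
    by (rule nn_integral_distr) measurable
  also have "\<dots> = (\<integral>\<^sup>+z. F (norm w + z $ i0) (\<Sum>i\<in>J. (z $ i)\<^sup>2) \<partial>std_mvn)"
    unfolding case_prod_conv VT by (simp only: UT)
  also have "\<dots> = (\<integral>\<^sup>+y. F (norm w + y i0) (\<Sum>i\<in>J. (y i)\<^sup>2) \<partial>?N UNIV)"
  proof -
    have [measurable]: "(\<lambda>f. \<chi> i. f i) \<in> ?N UNIV \<rightarrow>\<^sub>M (borel :: (real ^ 'n) measure)"
      using measurable_vec_lambda by (simp cong: measurable_cong_sets sets_PiM_cong)
    have [measurable]: "(\<lambda>z::real^'n. z $ i) \<in> borel_measurable borel" for i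
      by (intro borel_measurable_continuous_onI continuous_intros)
    have "(\<lambda>z::real^'n. F (norm w + z $ i0) (\<Sum>i\<in>J. (z $ i)\<^sup>2)) \<in> borel_measurable borel"
      unfolding F_def by measurable
    then show ?thesis unfolding std_mvn_eq_PiM by (subst nn_integral_distr) (simp_all, measurable)
  qed
  also have "\<dots> = (\<integral>\<^sup>+x. \<integral>\<^sup>+y. F (norm w + x) (\<Sum>i\<in>J. (y i)\<^sup>2) \<partial>?N ?I \<partial>gauss 0)"
  proof -
    have m: "(\<lambda>y. F (norm w + y i0) (\<Sum>i\<in>J. (y i)\<^sup>2)) \<in> borel_measurable (?N (insert i0 ?I))"
      unfolding insI F_def by measurable
    have s: "(\<Sum>i\<in>J. ((y(i0 := x)) i)\<^sup>2) = (\<Sum>i\<in>J. (y i)\<^sup>2)" for y :: "'n \<Rightarrow> real" and x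
      by (intro sum.cong) (auto simp: J_def)
    show ?thesis
      using pp.product_nn_integral_insert_rev[OF finI m] unfolding insI by (simp only: s fun_upd_same)
  qed
  also have "\<dots> = (\<integral>\<^sup>+x. \<integral>\<^sup>+s. F (norm w + x) s \<partial>chi_square n \<partial>gauss 0)"
  proof (rule nn_integral_cong)
    fix x
    have "(\<integral>\<^sup>+y. F (norm w + x) (\<Sum>i\<in>J. (y i)\<^sup>2) \<partial>?N ?I)
       = (\<integral>\<^sup>+y. F (norm w + x) (\<Sum>i\<in>J. (restrict y J i)\<^sup>2) \<partial>?N ?I)"
      by simp
    \<comment> \<open>The coordinates outside \<open>J\<close> belong to directions that
      \<open>P\<close> kills; restricting to \<open>J\<close> passes to the marginal law.\<close>
    also have "\<dots> = (\<integral>\<^sup>+y. F (norm w + x) (\<Sum>i\<in>J. (y i)\<^sup>2) \<partial>distr (?N ?I) (?N J) (\<lambda>y. restrict y J))"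
      by (rule nn_integral_distr[OF measurable_restrict_subset[OF JI], symmetric]) (unfold F_def, measurable)
    also have "distr (?N ?I) (?N J) (\<lambda>y. restrict y J) = ?N J"
      by (rule pp.distr_PiM_restrict_finite) (auto simp: J_def)
    also have "(\<integral>\<^sup>+y. F (norm w + x) (\<Sum>i\<in>J. (y i)\<^sup>2) \<partial>?N J) = (\<integral>\<^sup>+s. F (norm w + x) s \<partial>chi_square n)"
      unfolding cardJ[symmetric] by (rule nn_integral_PiM_gauss_central) (auto simp: J_def F_def)
    finally show "(\<integral>\<^sup>+y. F (norm w + x) (\<Sum>i\<in>J. (y i)\<^sup>2) \<partial>?N ?I) = (\<integral>\<^sup>+s. F (norm w + x) s \<partial>chi_square n)" .
  qed
  also have "\<dots> = (\<integral>\<^sup>+x. \<integral>\<^sup>+s. F x s \<partial>chi_square n \<partial>gauss (norm w))"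
    by (rule nn_integral_gauss_shift[of "\<lambda>x. \<integral>\<^sup>+s. F x s \<partial>chi_square n"]) (unfold F_def, measurable)
  also have "\<dots> = (\<integral>\<^sup>+p. case_prod F p \<partial>gauss_chi (norm w) n)"
    by (rule nn_integral_gauss_chi[OF F, symmetric])
  also have "\<dots> = emeasure (gauss_chi (norm w) n) S"
  proof -
    have "S \<in> sets (gauss_chi (norm w) n)"
      using S by (simp add: borel_prod[symmetric] cong: sets_pair_measure_cong)
    then show ?thesis by (simp add: F_ind)
  qed
  finally show "emeasure (distr std_mvn borel ?f) S = emeasure (gauss_chi (norm w) n) S" .
qed

section \<open>The moment identity for the standard normal law on vectors, and the theorem\<close>

lemma integral_std_mvn_projection:
  fixes P G :: "real ^ 'n ^ 'n" and h :: "real \<Rightarrow> real"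
  assumes h[measurable]: "h \<in> borel_measurable borel"
    and sym: "transpose P = P" and idem: "P ** P = P" and w: "P *v w = w"
    and int: "integrable std_mvn (\<lambda>z. h ((norm (P *v (w + z)))\<^sup>2) *\<^sub>R (G *v (w + z)))"
    and Q: "noncentral_chi_square (rank P + 2) (w \<bullet> w) Q" and intQ: "integrable Q h"
  shows "(\<integral>z. h ((norm (P *v (w + z)))\<^sup>2) *\<^sub>R (G *v (w + z)) \<partial>std_mvn) = (\<integral>t. h t \<partial>Q) *\<^sub>R (G *v w)"
proof -
  define H where "H z = h ((norm (P *v (w + z)))\<^sup>2) *\<^sub>R (G *v (w + z))" for z
  have [measurable]: "H \<in> borel_measurable borel" unfolding H_def by measurable
  have intH: "integrable std_mvn H" using int by (simp add: H_def[abs_def])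
  have inv: "integrable std_mvn (\<lambda>z. H (T z))" "(\<integral>z. H (T z) \<partial>std_mvn) = (\<integral>z. H z \<partial>std_mvn)"
    if T: "orthogonal_transformation T" for T :: "real ^ 'n \<Rightarrow> real ^ 'n"
  proof -
    have [measurable]: "T \<in> borel_measurable borel" using orthogonal_transformation_linear[OF T]
      by (intro borel_measurable_continuous_onI linear_continuous_on) (metis linear_conv_bounded_linear)
    show "integrable std_mvn (\<lambda>z. H (T z))"
      using intH by (subst (asm) distr_std_mvn_orthogonal[OF T, symmetric]) (simp add: integrable_distr_eq)
    show "(\<integral>z. H (T z) \<partial>std_mvn) = (\<integral>z. H z \<partial>std_mvn)"
      by (subst (2) distr_std_mvn_orthogonal[OF T, symmetric]) (simp add: integral_distr)
  qed
  have "(\<integral>z. H z \<partial>std_mvn) = (\<integral>t. h t \<partial>Q) *\<^sub>R (G *v w)"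
  proof (cases "w = 0")
    case True
    have "orthogonal_transformation (uminus :: real ^ 'n \<Rightarrow> real ^ 'n)"
      by (simp add: orthogonal_transformation_def linear_uminus)
    from inv(2)[OF this] have "- (\<integral>z. H z \<partial>std_mvn) = (\<integral>z. H z \<partial>std_mvn)"
      using True by (simp add: H_def linear_neg[OF matrix_vector_mul_linear])
    moreover have "2 *\<^sub>R v = v - (- v)" for v :: "real ^ 'n" by (simp add: scaleR_2)
    ultimately have "2 *\<^sub>R (\<integral>z. H z \<partial>std_mvn) = 0" by (metis diff_self)
    then have "(\<integral>z. H z \<partial>std_mvn) = 0" unfolding scaleR_eq_0_iff by simp
    then show ?thesis using True by simp
  next
    case False
    define d where "d = norm w"
    have d: "d > 0" using False by (simp add: d_def)
    have ww: "w \<bullet> w = d\<^sup>2" by (simp add: d_def power2_norm_eq_inner)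
    define U where "U z = d + (w \<bullet> z) / d" for z
    \<comment> \<open>The reflection commutes with \<open>P\<close> because \<open>P\<close> is
      symmetric and fixes \<open>w\<close>. The weight \<open>h\<close> therefore takes the same
      value at \<open>z\<close> and \<open>T z\<close>, while the components of \<open>w + z\<close>
      and \<open>w + T z\<close> orthogonal to \<open>w\<close> cancel in the sum.\<close>
    define T where "T x = (2 * (w \<bullet> x) / d\<^sup>2) *\<^sub>R w - x" for x
    have linT: "linear T"
      by (rule linearI) (auto simp: T_def inner_add_right algebra_simps add_divide_distrib)
    have "T x \<bullet> T y = x \<bullet> y" for x y
      using d by (simp add: T_def inner_diff_left inner_diff_right ww inner_commute power2_eq_square field_simps)
    then have T: "orthogonal_transformation T" using linT by (simp add: orthogonal_transformation_def)
    have Tw: "T w = w" using d by (simp add: T_def ww scaleR_2)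
    have PT: "P *v T x = T (P *v x)" for x
      using matrix_inner_commute[OF sym, of w x] w
      by (simp add: T_def matrix_vector_mult_diff_distrib matrix_vector_mult_scaleR)
    define c where "c z = h ((norm (P *v (w + z)))\<^sup>2) * U z" for z
    have HT: "H z + H (T z) = (2 / d * c z) *\<^sub>R (G *v w)" for z
    proof -
      have wT: "w + T z = T (w + z)" by (simp add: linear_add[OF linT] Tw)
      have "norm (P *v (w + T z)) = norm (P *v (w + z))"
        unfolding wT PT by (rule orthogonal_transformation_norm[OF T])
      moreover have "G *v (w + z) + G *v (w + T z) = (2 / d * U z) *\<^sub>R (G *v w)"
      proof -
        have "(w + z) + (w + T z) = (2 / d * U z) *\<^sub>R w"
          unfolding wT using d by (simp add: T_def inner_add_right ww U_def field_simps power2_eq_square)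
        then show ?thesis by (metis matrix_vector_right_distrib matrix_vector_mult_scaleR)
      qed
      ultimately show ?thesis
        by (simp add: H_def c_def scaleR_add_right[symmetric] mult_ac)
    qed
    have int2: "integrable std_mvn (\<lambda>z. (2 / d * c z) *\<^sub>R (G *v w))"
      unfolding HT[symmetric] by (intro Bochner_Integration.integrable_add intH inv(1) T)
    have I2: "2 *\<^sub>R (\<integral>z. H z \<partial>std_mvn) = (\<integral>z. (2 / d * c z) *\<^sub>R (G *v w) \<partial>std_mvn)"
      unfolding HT[symmetric]
      by (subst Bochner_Integration.integral_add) (simp_all only: intH inv[OF T] scaleR_2)
    \<comment> \<open>The vector integrand determines the scalar \<open>c\<close> only through a
      nonzero \<open>G w\<close>, and pairing with that vector yields integrability of
      \<open>c\<close>. If \<open>G w = 0\<close>, the averaged integrand vanishes identically and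
      both sides are 0.\<close>
    show ?thesis
    proof (cases "G *v w = 0")
      case True
      then show ?thesis using I2 by simp
    next
      case Gw: False
      have "integrable std_mvn (\<lambda>z. ((2 / d * c z) *\<^sub>R (G *v w)) \<bullet> (G *v w))"
        by (rule integrable_inner_left) (use int2 in simp)
      then have "integrable std_mvn (\<lambda>z. (2 / d * ((G *v w) \<bullet> (G *v w))) * c z)"
        by (simp add: mult_ac)
      from integrable_mult_right[OF this, of "1 / (2 / d * ((G *v w) \<bullet> (G *v w)))"]
      have intc: "integrable std_mvn c" using Gw d by simp
      \<comment> \<open>A nonzero \<open>w\<close> lies in the range of \<open>P\<close>, so the
        rank is positive and n = rank P - 1 counts the directions of the range orthogonal to
        \<open>w\<close>.\<close>
      have "rank P \<noteq> 0"
      proof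
        assume "rank P = 0"
        then have "P *v w = 0" by (simp add: rank_dim_range dim_eq_0 image_subset_iff)
        then show False using w False by simp
      qed
      then obtain n where n: "rank P = Suc n" using not0_implies_Suc by blast
      let ?f = "\<lambda>z. (U z, (norm (P *v (w + z)))\<^sup>2 - (U z)\<^sup>2)"
      have law: "distr std_mvn borel ?f = gauss_chi d n"
        using std_mvn_projection_law[OF sym idem w False n] by (simp add: d_def U_def)
      have [measurable]: "U \<in> borel_measurable borel" unfolding U_def by measurable
      have [measurable]: "?f \<in> borel_measurable borel" unfolding borel_prod[symmetric] by measurable
      define g where "g = (\<lambda>(x, s). h (x\<^sup>2 + s) * x)"
      have [measurable]: "g \<in> borel_measurable borel" unfolding g_def borel_prod[symmetric] by measurable
      have gc: "g (?f z) = c z" for z by (simp add: g_def c_def)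
      have ig: "integrable (gauss_chi d n) g"
        unfolding law[symmetric] by (subst integrable_distr_eq) (simp_all only: gc intc, measurable)
      have eg: "(\<integral>p. g p \<partial>gauss_chi d n) = (\<integral>z. c z \<partial>std_mvn)"
        unfolding law[symmetric] by (subst integral_distr) (measurable, simp only: gc)
      \<comment> \<open>rank P + 2 = n + 3: one degree of freedom for the coordinate with mean
        \<open>d\<close>, and the n + 2 central ones that the moment identity produces.\<close>
      have "noncentral_chi_square (Suc (n + 2)) (w \<bullet> w) Q" using Q n by simp
      then have Qd: "Q = distr (gauss_chi d (n + 2)) borel (\<lambda>(x, s). x\<^sup>2 + s)"
        using noncentral_chi_square_Suc[of "n + 2" "d\<^sup>2" Q] d by (simp add: ww del: chi_square.simps)
      have m: "(\<lambda>(x, s). x\<^sup>2 + s) \<in> borel_measurable (gauss_chi d (n + 2))"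
        by measurable
      have iQ: "integrable (gauss_chi d (n + 2)) (\<lambda>(x, s). h (x\<^sup>2 + s))"
        using intQ unfolding Qd integrable_distr_eq[OF m h] by (simp add: case_prod_beta' del: chi_square.simps)
      have eQ: "(\<integral>t. h t \<partial>Q) = (\<integral>(x, s). h (x\<^sup>2 + s) \<partial>gauss_chi d (n + 2))"
        unfolding Qd integral_distr[OF m h] by (simp add: case_prod_beta' del: chi_square.simps)
      have "(\<integral>z. c z \<partial>std_mvn) = d * (\<integral>t. h t \<partial>Q)"
        unfolding eg[symmetric] eQ g_def
        by (rule integral_gauss_chi_first_moment[OF h d ig[unfolded g_def] iQ])
      then have "(\<integral>z. (2 / d * c z) *\<^sub>R (G *v w) \<partial>std_mvn) = (2 * (\<integral>t. h t \<partial>Q)) *\<^sub>R (G *v w)"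
        using d intc by (subst integral_scaleR_left) auto
      then have "2 *\<^sub>R (\<integral>z. H z \<partial>std_mvn) = 2 *\<^sub>R ((\<integral>t. h t \<partial>Q) *\<^sub>R (G *v w))"
        using I2 by simp
      then show ?thesis by (rule scaleR_left_imp_eq[rotated]) simp
    qed
  qed
  then show ?thesis by (simp add: H_def)
qed

theorem theoremC1:
  fixes M :: "'a measure" and N :: "'b measure"
    and X :: "'a \<Rightarrow> real ^ 'p" and Y :: "'b \<Rightarrow> real"
    and h :: "real \<Rightarrow> real"
    and \<mu> :: "real ^ 'p"
    and \<Sigma> A W Wstar :: "real ^ 'p ^ 'p"
    and k :: nat
  assumes "h \<in> borel_measurable borel"
    and "nonneg_def \<Sigma>" and "rank \<Sigma> = k" and "k \<le> CARD('p)"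
    and "prob_space M" and "X \<in> borel_measurable M" and "distr M borel X = mvn \<mu> \<Sigma>"
    and "nonneg_def A" and "rank A = k"
    and "(\<Sigma> ** A) ** (\<Sigma> ** A) = \<Sigma> ** A"
    and "A ** \<Sigma> ** A = A"
    and "\<Sigma> ** A ** \<Sigma> = \<Sigma>"
    and "(\<Sigma> ** A) *v \<mu> = \<mu>"
    and "nonneg_def Wstar"
    and "W = nonneg_sqrt A ** Wstar ** nonneg_sqrt A"
    and "prob_space N" and "Y \<in> borel_measurable N"
    and "noncentral_chi_square (k + 2) (\<mu> \<bullet> (A *v \<mu>)) (distr N borel Y)"
    and "integrable M (\<lambda>\<omega>. h (X \<omega> \<bullet> (A *v X \<omega>)) *\<^sub>R (W *v X \<omega>))"
    and "integrable N (\<lambda>\<omega>. h (Y \<omega>))"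
  shows "prob_space.expectation M (\<lambda>\<omega>. h (X \<omega> \<bullet> (A *v X \<omega>)) *\<^sub>R (W *v X \<omega>))
       = prob_space.expectation N (\<lambda>\<omega>. h (Y \<omega>)) *\<^sub>R (W *v \<mu>)"
proof -
  note [measurable] = assms(1,6,17)
  define S where "S = nonneg_sqrt \<Sigma>"
  have tS: "transpose S = S" and SS: "S ** S = \<Sigma>" using nonneg_sqrt[OF assms(2)] by (simp_all add: S_def)
  have tA: "transpose A = A" using assms(8) by (simp add: nonneg_def_def)
  have SSv: "S *v (S *v x) = \<Sigma> *v x" for x by (simp add: matrix_vector_mul_assoc SS)
  have A\<Sigma>A: "A *v (\<Sigma> *v (A *v x)) = A *v x" for x
    using assms(11) by (simp add: matrix_vector_mul_assoc matrix_mul_assoc)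
  have \<Sigma>A\<mu>: "\<Sigma> *v (A *v \<mu>) = \<mu>" using assms(13) by (simp add: matrix_vector_mul_assoc)
  define P where "P = S ** A ** S"
  \<comment> \<open>Chosen so that \<open>S w = \<Sigma> A \<mu> = \<mu>\<close>; then
    \<open>\<mu> + S z = S (w + z)\<close>, and mean and noise pass through the same matrix.\<close>
  define w where "w = S *v (A *v \<mu>)"
  have Pv: "P *v x = S *v (A *v (S *v x))" for x
    by (simp add: P_def matrix_vector_mul_assoc matrix_mul_assoc)
  have tP: "transpose P = P" by (simp add: P_def matrix_transpose_mul tS tA matrix_mul_assoc)
  have PP: "P ** P = P"
    by (subst matrix_eq) (simp add: matrix_vector_mul_assoc[symmetric] Pv SSv A\<Sigma>A)
  have Pw: "P *v w = w" by (simp add: Pv w_def SSv A\<Sigma>A)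
  have rankP: "rank P = k"
  proof (rule antisym)
    show "rank P \<le> k" unfolding P_def assms(9)[symmetric]
      by (rule order_trans[OF rank_mul_le_left rank_mul_le_right])
    \<comment> \<open>The relation \<open>\<Sigma> A \<Sigma> = \<Sigma>\<close> recovers
      \<open>\<Sigma>\<close> from \<open>P\<close>, so the rank of \<open>P\<close> cannot have
      dropped below k.\<close>
    have "\<Sigma> = S ** P ** S"
      by (subst matrix_eq)
        (simp add: matrix_vector_mul_assoc[symmetric] Pv SSv, simp add: matrix_vector_mul_assoc matrix_mul_assoc assms(12))
    then show "k \<le> rank P" unfolding assms(3)[symmetric]
      by (metis order_trans[OF rank_mul_le_left rank_mul_le_right])
  qed
  have ww: "w \<bullet> w = \<mu> \<bullet> (A *v \<mu>)"
    by (simp add: w_def matrix_inner_commute[OF tS] SSv \<Sigma>A\<mu> inner_commute)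
  define g where "g x = h (x \<bullet> (A *v x)) *\<^sub>R (W *v x)" for x
  have [measurable]: "g \<in> borel_measurable borel" unfolding g_def by measurable
  have gz: "g (\<mu> + S *v z) = h ((norm (P *v (w + z)))\<^sup>2) *\<^sub>R ((W ** S) *v (w + z))" for z
  proof -
    let ?x = "\<mu> + S *v z"
    have x: "S *v (w + z) = ?x" by (simp add: matrix_vector_right_distrib w_def SSv \<Sigma>A\<mu>)
    have "(norm (P *v (w + z)))\<^sup>2 = (S *v (A *v ?x)) \<bullet> (S *v (A *v ?x))"
      by (simp add: power2_norm_eq_inner Pv x)
    also have "\<dots> = ?x \<bullet> (A *v ?x)"
      by (simp only: matrix_inner_commute[OF tS] matrix_inner_commute[OF tA] SSv A\<Sigma>A)
    finally show ?thesis by (simp add: g_def x matrix_vector_mul_assoc[symmetric])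
  qed
  have mz: "(\<lambda>z. \<mu> + S *v z) \<in> std_mvn \<rightarrow>\<^sub>M borel" by measurable
  have "integrable (distr M borel X) g"
    using assms(19) by (subst integrable_distr_eq) (auto simp: g_def)
  then have int: "integrable std_mvn (\<lambda>z. g (\<mu> + S *v z))"
    unfolding assms(7) mvn_def S_def[symmetric] by (subst (asm) integrable_distr_eq[OF mz]) auto
  have "(\<integral>\<omega>. g (X \<omega>) \<partial>M) = (\<integral>x. g x \<partial>distr M borel X)"
    by (rule integral_distr[symmetric]) measurable
  also have "\<dots> = (\<integral>z. g (\<mu> + S *v z) \<partial>std_mvn)"
    unfolding assms(7) mvn_def S_def[symmetric] by (rule integral_distr[OF mz]) measurable
  \<comment> \<open>The role of \<open>G\<close> is played by \<open>W ** S\<close>, which maps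
    \<open>w + z\<close> to W X and \<open>w\<close> to W \<mu>.\<close>
  also have "\<dots> = (\<integral>t. h t \<partial>distr N borel Y) *\<^sub>R ((W ** S) *v w)"
    unfolding gz
  proof (rule integral_std_mvn_projection[OF assms(1) tP PP Pw])
    show "integrable std_mvn (\<lambda>z. h ((norm (P *v (w + z)))\<^sup>2) *\<^sub>R ((W ** S) *v (w + z)))"
      using int by (simp add: gz)
    show "noncentral_chi_square (rank P + 2) (w \<bullet> w) (distr N borel Y)"
      using assms(18) by (simp add: rankP ww)
    show "integrable (distr N borel Y) h"
      using assms(20) by (subst integrable_distr_eq) auto
  qed
  also have "(\<integral>t. h t \<partial>distr N borel Y) = (\<integral>\<omega>. h (Y \<omega>) \<partial>N)"
    by (rule integral_distr) measurable
  also have "(W ** S) *v w = W *v \<mu>"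
    by (simp add: matrix_vector_mul_assoc[symmetric] w_def SSv \<Sigma>A\<mu>)
  finally show ?thesis by (simp add: g_def)
qed

end
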